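(* Let $\mathcal L$ be a unimodular probability measure on $\mathcal G_*$ supported by cavity-monotone networks, and assume $\mathcal L[\mathrm{rank}(\mu_\circ)]<\infty$. Then for every $t>0$, $\mathcal L$-almost surely the cavity equation $\mathbf x=t\Gamma_G(\mathbf x)$ on $G$ admits a unique solution $\mathbf x(t)\in[0,\infty)^{\vec E}$, and it is globally attractive: from every initial configuration, the iterates of $t\Gamma_G$ converge coordinatewise to $\mathbf x(t)$.
   Context: Measures over subsets: for a finite set $E$, a measure is $\mu:2^E\to[0,\infty)$; $Z(\mathbf w)=\sum_{F\subseteq E}\mu(F)\mathbf w^F$, $\mathbf w^F=\prod_{e\in F}w_e$; the cavity ratio is $\Gamma^e_\mu(\mathbf w')=Z^{/e}(\mathbf w')/Z^{\setminus e}(\mathbf w')$ where $Z^{\setminus e}(\mathbf w')=\sum_{F\not\ni e}\mu(F)\mathbf w'^F$, $Z^{/e}(\mathbf w')=\sum_{F\not\ni e}\mu(F\cup\{e\})\mathbf w'^F$; for $\mathbf w\in[0,\infty)^E$ with $Z(\mathbf w)>0$, $\mathbb P^{\mathbf w}_\mu(\mathcal F=F)=\mu(F)\mathbf w^F/Z(\mathbf w)$ and $U_\mu(\mathbf w)=\mathbb E^{\mathbf w}_\mu|\mathcal F|$. $\mathrm{rank}(\mu)=\max\{|F|:\mu(F)>0\}$. $\mu$ is Rayleigh if for all $\mathbf w\in(0,\infty)^E$, $e\neq f$: $\mathbb P^{\mathbf w}_\mu(e,f\in\mathcal F)\le\mathbb P^{\mathbf w}_\mu(e\in\mathcal F)\mathbb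 P^{\mathbf w}_\mu(f\in\mathcal F)$; size-increasing if for all $\mathbf w\in(0,\infty)^E$, $e\in E$: $\mathbb E^{\mathbf w}_\mu[|\mathcal F|\mathbf 1_{e\in\mathcal F}]>\mathbb E^{\mathbf w}_\mu|\mathcal F|\,\mathbb P^{\mathbf w}_\mu(e\in\mathcal F)$; cavity-monotone if $\mu(\emptyset)>0$, Rayleigh and size-increasing. Networks: a network is a simple locally finite (possibly infinite, countable) graph $G=(V,E)$ with, for each $i\in V$, a local measure $\mu_i$ over the subsets of $E_i$ (edges incident to $i$); it is cavity-monotone if every $\mu_i$ is. $\partial i$ is the set of neighbours of $i$. A configuration is $\mathbf x\in[0,\infty)^{\vec E}$ indexed by oriented edges. The cavity operator is $\Gamma_G(\mathbf x)=\mathbf y$ with $y_{i\to j}=\Gamma^{ij}_{\mu_i}(x_{k\to i}:k\in\partial i\setminus\{j\})$. The cavity equation at activity $t>0$ is $\mathbf x=t\Gamma_G(\mathbf x)$. Rooted networks: a rooted network $(G,\circ)$ is a connected locally finite network with a distinguished vertex $\circ$; $\mathcal G_*$ is the set of rooted networks up to isomorphism (root-preserving graph isomorphisms carrying local measures onto local measures), with the topology of local convergence (see below), a Polish space. $\mathcal G_{**}$ is the analogous space of connected networks with an ordered pair $(\circ,i)$ of adjacent distinguished vertices. $\mathcal L\in\mathcal P(\mathcal G_* )$ is unimodular if for every Borel $f:\mathcal G_{**}\to[0,\infty]$, $\mathcal L[\sum_{i\in\partial\circ}f(G,\circ,i)]=\mathcal L[\sum_{i\in\partial\circ}f(G,i,\circ)]$.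 Local convergence: $(G_n,\circ_n)\to(G,\circ)$ if for every $k$ and $\varepsilon>0$, for all large $n$ there is a bijection between the vertex sets of the radius-$k$ balls $[G_n,\circ_n]_k$ and $[G,\circ]_k$ preserving root, adjacency, supports of local measures, and values of local measures up to $\varepsilon$. *)

theory Defs
  imports "HOL-Analysis.Analysis" "HOL-Probability.Probability"
begin

section \<open>Measures over subsets of a finite ground set E\<close>

text \<open>A measure is mu :: 'a set => real (meaningful on subsets of E, values >= 0);
 weights w :: 'a => real.\<close>

definition Zw :: "'a set \<Rightarrow> ('a set \<Rightarrow> real) \<Rightarrow> ('a \<Rightarrow> real) \<Rightarrow> real" where
  "Zw E mu w = (\<Sum>F\<in>Pow E. mu F * prod w F)"

definition Pw :: "'a set \<Rightarrow> ('a set \<Rightarrow> real) \<Rightarrow> ('a \<Rightarrow> real) \<Rightarrow> 'a set \<Rightarrow> real" where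
  "Pw E mu w F = mu F * prod w F / Zw E mu w"

text \<open>Probability that the random set contains A.\<close>
definition prob_incl :: "'a set \<Rightarrow> ('a set \<Rightarrow> real) \<Rightarrow> ('a \<Rightarrow> real) \<Rightarrow> 'a set \<Rightarrow> real" where
  "prob_incl E mu w A = (\<Sum>F\<in>{F\<in>Pow E. A \<subseteq> F}. Pw E mu w F)"

definition exp_size :: "'a set \<Rightarrow> ('a set \<Rightarrow> real) \<Rightarrow> ('a \<Rightarrow> real) \<Rightarrow> real" where
  "exp_size E mu w = (\<Sum>F\<in>Pow E. real (card F) * Pw E mu w F)"

definition exp_size_incl :: "'a set \<Rightarrow> ('a set \<Rightarrow> real) \<Rightarrow> ('a \<Rightarrow> real) \<Rightarrow> 'a \<Rightarrow> real" where
  "exp_size_incl E mu w e = (\<Sum>F\<in>{F\<in>Pow E. e \<in> F}. real (card F) * Pw E mu w F)"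

definition rayleigh :: "'a set \<Rightarrow> ('a set \<Rightarrow> real) \<Rightarrow> bool" where
  "rayleigh E mu \<longleftrightarrow> (\<forall>w. (\<forall>e\<in>E. 0 < w e) \<longrightarrow>
     (\<forall>e\<in>E. \<forall>f\<in>E. e \<noteq> f \<longrightarrow>
        prob_incl E mu w {e, f} \<le> prob_incl E mu w {e} * prob_incl E mu w {f}))"

definition size_increasing :: "'a set \<Rightarrow> ('a set \<Rightarrow> real) \<Rightarrow> bool" where
  "size_increasing E mu \<longleftrightarrow> (\<forall>w. (\<forall>e\<in>E. 0 < w e) \<longrightarrow>
     (\<forall>e\<in>E. exp_size_incl E mu w e > exp_size E mu w * prob_incl E mu w {e}))"

definition cavity_monotone :: "'a set \<Rightarrow> ('a set \<Rightarrow> real) \<Rightarrow> bool" where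
  "cavity_monotone E mu \<longleftrightarrow> 0 < mu {} \<and> rayleigh E mu \<and> size_increasing E mu"

definition rank_of :: "'a set \<Rightarrow> ('a set \<Rightarrow> real) \<Rightarrow> nat" where
  "rank_of E mu = Max (card ` {F. F \<subseteq> E \<and> 0 < mu F})"

text \<open>Z^{\e} and Z^{/e} and the cavity ratio Gamma^e_mu.\<close>
definition Z_del :: "'a set \<Rightarrow> ('a set \<Rightarrow> real) \<Rightarrow> 'a \<Rightarrow> ('a \<Rightarrow> real) \<Rightarrow> real" where
  "Z_del E mu e w = (\<Sum>F\<in>Pow (E - {e}). mu F * prod w F)"

definition Z_con :: "'a set \<Rightarrow> ('a set \<Rightarrow> real) \<Rightarrow> 'a \<Rightarrow> ('a \<Rightarrow> real) \<Rightarrow> real" where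
  "Z_con E mu e w = (\<Sum>F\<in>Pow (E - {e}). mu (insert e F) * prod w F)"

definition cavity_ratio :: "'a set \<Rightarrow> ('a set \<Rightarrow> real) \<Rightarrow> 'a \<Rightarrow> ('a \<Rightarrow> real) \<Rightarrow> real" where
  "cavity_ratio E mu e w = Z_con E mu e w / Z_del E mu e w"

section \<open>Networks (concrete representatives on vertex type nat)\<close>

text \<open>The edges incident to vertex i are identified with the neighbours of i:
  edge {i,j} in E_i corresponds to j. So lm N i is the local measure mu_i,
  a function on sets of neighbours of i.\<close>

record network =
  verts :: "nat set"
  adj :: "nat \<Rightarrow> nat \<Rightarrow> bool"
  lm :: "nat \<Rightarrow> nat set \<Rightarrow> real"

type_synonym rnet = "network \<times> nat"
type_synonym dnet = "network \<times> nat \<times> nat"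

definition nbrs :: "network \<Rightarrow> nat \<Rightarrow> nat set" where
  "nbrs N i = {j. adj N i j}"

definition edge_rel :: "network \<Rightarrow> (nat \<times> nat) set" where
  "edge_rel N = {(i, j). adj N i j}"

definition wf_network :: "network \<Rightarrow> bool" where
  "wf_network N \<longleftrightarrow>
     (\<forall>i j. adj N i j \<longrightarrow> i \<in> verts N \<and> j \<in> verts N) \<and>
     (\<forall>i j. adj N i j \<longrightarrow> adj N j i) \<and>
     (\<forall>i. \<not> adj N i i) \<and>
     (\<forall>i\<in>verts N. finite (nbrs N i)) \<and>
     (\<forall>i F. 0 \<le> lm N i F) \<and>
     (\<forall>i F. \<not> (i \<in> verts N \<and> F \<subseteq> nbrs N i) \<longrightarrow> lm N i F = 0)"

definition wf_rooted :: "rnet \<Rightarrow> bool" where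
  "wf_rooted G \<longleftrightarrow> wf_network (fst G) \<and> snd G \<in> verts (fst G) \<and>
     (\<forall>v\<in>verts (fst G). (snd G, v) \<in> (edge_rel (fst G))\<^sup>*)"

definition wf_droot :: "dnet \<Rightarrow> bool" where
  "wf_droot G \<longleftrightarrow> (case G of (N, r, s) \<Rightarrow> wf_rooted (N, r) \<and> adj N r s)"

definition cavity_monotone_network :: "network \<Rightarrow> bool" where
  "cavity_monotone_network N \<longleftrightarrow> (\<forall>i\<in>verts N. cavity_monotone (nbrs N i) (lm N i))"

section \<open>Local topology\<close>

definition ball :: "network \<Rightarrow> nat \<Rightarrow> nat \<Rightarrow> nat set" where
  "ball N r k = {v. \<exists>n\<le>k. (r, v) \<in> edge_rel N ^^ n}"

text \<open>Vertices at distance < k: all their neighbours lie in the radius-k ball.\<close>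
definition inner_ball :: "network \<Rightarrow> nat \<Rightarrow> nat \<Rightarrow> nat set" where
  "inner_ball N r k = {v. \<exists>n<k. (r, v) \<in> edge_rel N ^^ n}"

definition ball_match :: "network \<Rightarrow> nat \<Rightarrow> network \<Rightarrow> nat \<Rightarrow> nat \<Rightarrow> real \<Rightarrow> (nat \<Rightarrow> nat) \<Rightarrow> bool" where
  "ball_match N r N' r' k \<epsilon> \<phi> \<longleftrightarrow>
     bij_betw \<phi> (ball N r k) (ball N' r' k) \<and> \<phi> r = r' \<and>
     (\<forall>u\<in>ball N r k. \<forall>v\<in>ball N r k. adj N u v \<longleftrightarrow> adj N' (\<phi> u) (\<phi> v)) \<and>
     (\<forall>u\<in>inner_ball N r k. \<forall>F. F \<subseteq> nbrs N u \<longrightarrow>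
        (0 < lm N u F \<longleftrightarrow> 0 < lm N' (\<phi> u) (\<phi> ` F)) \<and>
        \<bar>lm N u F - lm N' (\<phi> u) (\<phi> ` F)\<bar> \<le> \<epsilon>)"

definition loc_conv_r :: "(nat \<Rightarrow> rnet) \<Rightarrow> rnet \<Rightarrow> bool" where
  "loc_conv_r Gs G \<longleftrightarrow> (\<forall>k. \<forall>\<epsilon>>0. eventually (\<lambda>n.
     \<exists>\<phi>. ball_match (fst (Gs n)) (snd (Gs n)) (fst G) (snd G) k \<epsilon> \<phi>) sequentially)"

definition loc_conv_d :: "(nat \<Rightarrow> dnet) \<Rightarrow> dnet \<Rightarrow> bool" where
  "loc_conv_d Gs G \<longleftrightarrow> (\<forall>k. \<forall>\<epsilon>>0. eventually (\<lambda>n.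
     \<exists>\<phi>. ball_match (fst (Gs n)) (fst (snd (Gs n))) (fst G) (fst (snd G)) k \<epsilon> \<phi> \<and>
          \<phi> (snd (snd (Gs n))) = snd (snd G)) sequentially)"

definition loc_cont_r :: "(rnet \<Rightarrow> real) \<Rightarrow> bool" where
  "loc_cont_r f \<longleftrightarrow> (\<forall>Gs G. (\<forall>n. wf_rooted (Gs n)) \<longrightarrow> wf_rooted G \<longrightarrow> loc_conv_r Gs G \<longrightarrow>
      (\<lambda>n. f (Gs n)) \<longlonglongrightarrow> f G)"

definition loc_cont_d :: "(dnet \<Rightarrow> real) \<Rightarrow> bool" where
  "loc_cont_d f \<longleftrightarrow> (\<forall>Gs G. (\<forall>n. wf_droot (Gs n)) \<longrightarrow> wf_droot G \<longrightarrow> loc_conv_d Gs G \<longrightarrow>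
      (\<lambda>n. f (Gs n)) \<longlonglongrightarrow> f G)"

text \<open>Borel sigma-algebras of G_* and G_** pulled back to concrete representatives:
 generated by the (sequentially) continuous real functions (Baire = Borel in metrizable spaces).\<close>
definition rooted_sigma :: "rnet measure" where
  "rooted_sigma = sigma (Collect wf_rooted)
     {f -` U \<inter> Collect wf_rooted | f U. loc_cont_r f \<and> open (U :: real set)}"

definition droot_sigma :: "dnet measure" where
  "droot_sigma = sigma (Collect wf_droot)
     {f -` U \<inter> Collect wf_droot | f U. loc_cont_d f \<and> open (U :: real set)}"

definition unimodular :: "rnet measure \<Rightarrow> bool" where
  "unimodular L \<longleftrightarrow> (\<forall>f :: dnet \<Rightarrow> ennreal. f \<in> borel_measurable droot_sigma \<longrightarrow>
     (\<integral>\<^sup>+ G. (\<Sum>i\<in>nbrs (fst G) (snd G). f (fst G, snd G, i)) \<partial>L) =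
     (\<integral>\<^sup>+ G. (\<Sum>i\<in>nbrs (fst G) (snd G). f (fst G, i, snd G)) \<partial>L))"

section \<open>Cavity operator\<close>

text \<open>Configurations indexed by oriented edges i->j (x i j), zero off the oriented edges.\<close>
definition config :: "network \<Rightarrow> (nat \<Rightarrow> nat \<Rightarrow> real) set" where
  "config N = {x. \<forall>i j. (adj N i j \<longrightarrow> 0 \<le> x i j) \<and> (\<not> adj N i j \<longrightarrow> x i j = 0)}"

definition cavity_op :: "network \<Rightarrow> (nat \<Rightarrow> nat \<Rightarrow> real) \<Rightarrow> nat \<Rightarrow> nat \<Rightarrow> real" where
  "cavity_op N x = (\<lambda>i j. if adj N i j
      then cavity_ratio (nbrs N i) (lm N i) j (\<lambda>k. x k i) else 0)"

definition cav_map :: "network \<Rightarrow> real \<Rightarrow> (nat \<Rightarrow> nat \<Rightarrow> real) \<Rightarrow> nat \<Rightarrow> nat \<Rightarrow> real" where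
  "cav_map N t x = (\<lambda>i j. t * cavity_op N x i j)"

end

theory Submission
  imports Defs
begin

text \<open>The Rayleigh property makes the cavity map antitone, so its iterates from the zero configuration
  sandwich all others: the even ones increase to some \<open>lo\<close>, the odd ones decrease to some \<open>hi\<close>, and
  the cavity map exchanges \<open>lo\<close> and \<open>hi\<close>. Existence, uniqueness and attractiveness all follow once
  \<open>lo = hi\<close>. Now \<open>U\<^sub>\<circ>(lo) = \<Sum>\<^sub>i lo\<^sub>i\<^sub>\<circ> hi\<^sub>\<circ>\<^sub>i / (t + lo\<^sub>i\<^sub>\<circ> hi\<^sub>\<circ>\<^sub>i)\<close>,
  and exchanging the roles of \<open>\<circ>\<close> and \<open>i\<close> in the summand gives \<open>U\<^sub>\<circ>(hi)\<close>, so by unimodularity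
  both have the same expectation, which is finite since \<open>U \<le> rank\<close>. As \<open>U\<close> is strictly increasing, \<open>lo\<close>
  and \<open>hi\<close> agree on the edges pointing to the root; by unimodularity again, they then agree everywhere.\<close>

section \<open>Measures over subsets\<close>

text \<open>\<open>lo\<close> and \<open>hi\<close> depend on the whole network, so their regularity
  is not evident. Each finite iterate sees only a ball and is continuous for local convergence;
  measurability is proved for the iterates and passed to the limit, which is why the integrands at
  the end are written as \<open>lim\<close> of finite-level expressions. Both monotonicity
  statements are one-variable computations: the partition function is affine in each weight, so a
  cavity ratio or a mean size is a quotient of two affine functions of that weight, and the Rayleigh
  or size-increasing property fixes the sign of its determinant. These properties speak of strictly
  positive weights only, while the iteration starts at zero. Antitonicity is extended to the
  boundary by a limit; strict monotonicity can be used at \<open>lo\<close> because every cavity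
  ratio turns out to be strictly positive. An almost sure statement about the root says nothing by
  itself about the other vertices. Unimodularity carries it to the neighbours, one step at a time,
  and countably many steps exhaust a connected network.\<close>

lemma sum_Pow_split:
  fixes g :: "'a set \<Rightarrow> real"
  assumes "finite E" "e \<in> E"
  shows "(\<Sum>F\<in>Pow E. g F) = (\<Sum>F\<in>Pow (E - {e}). g F) + (\<Sum>F\<in>Pow (E - {e}). g (insert e F))"
proof -
  have "Pow E = Pow (E - {e}) \<union> insert e ` Pow (E - {e})"
    using Pow_insert[of e "E - {e}"] assms by (simp add: insert_absorb)
  moreover have "inj_on (insert e) (Pow (E - {e}))"
    by (auto simp: inj_on_def)
  moreover have "Pow (E - {e}) \<inter> insert e ` Pow (E - {e}) = {}"
    by auto
  ultimately show ?thesis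
    using assms by (simp add: sum.union_disjoint sum.reindex)
qed

lemma sum_Pow_containing:
  fixes g :: "'a set \<Rightarrow> real"
  assumes "finite E" "e \<in> E"
  shows "(\<Sum>F\<in>{F\<in>Pow E. e \<in> F}. g F) = (\<Sum>F\<in>Pow (E - {e}). g (insert e F))"
proof -
  have "(\<Sum>F\<in>{F\<in>Pow E. e \<in> F}. g F) = (\<Sum>F\<in>Pow E. if e \<in> F then g F else 0)"
    using assms by (intro sum.inter_filter) auto
  also have "\<dots> = (\<Sum>F\<in>Pow (E - {e}). g (insert e F))"
    unfolding sum_Pow_split[OF assms] by (auto intro!: sum.neutral)
  finally show ?thesis .
qed

lemma Zw_cong:
  assumes "\<And>k. k \<in> E \<Longrightarrow> w k = w' k"
  shows "Zw E mu w = Zw E mu w'"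
  unfolding Zw_def using assms by (intro sum.cong refl arg_cong2[where f = "(*)"] prod.cong) auto

lemma Z_del_eq_Zw: "Z_del E mu e = Zw (E - {e}) mu"
  and Z_con_eq_Zw: "Z_con E mu e = Zw (E - {e}) (\<lambda>F. mu (insert e F))"
  by (auto simp: Z_del_def Z_con_def Zw_def)

lemma cavity_ratio_cong:
  assumes "\<And>k. k \<in> E - {e} \<Longrightarrow> w k = w' k"
  shows "cavity_ratio E mu e w = cavity_ratio E mu e w'"
  using Zw_cong[of "E - {e}" w w'] assms by (simp add: cavity_ratio_def Z_del_eq_Zw Z_con_eq_Zw)

text \<open>Sets avoiding \<open>e\<close> and sets containing \<open>e\<close> give the constant
  term and the slope: the partition function is affine in \<open>w e\<close>, with deletion and
  contraction as coefficients. Every monotonicity argument below rests on this.\<close>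

lemma Zw_split:
  assumes "finite E" "e \<in> E"
  shows "Zw E mu w = Zw (E - {e}) mu w + w e * Zw (E - {e}) (\<lambda>F. mu (insert e F)) w"
proof -
  have "prod w (insert e F) = w e * prod w F" if "F \<in> Pow (E - {e})" for F
    using that assms finite_subset[of F E] by (subst prod.insert) auto
  then show ?thesis
    unfolding Zw_def sum_Pow_split[OF assms] sum_distrib_left
    by (simp add: mult_ac)
qed

lemma tendsto_Zw:
  assumes "finite E" "\<And>k. k \<in> E \<Longrightarrow> ((\<lambda>a. w a k) \<longlongrightarrow> v k) \<F>"
    and "\<And>F. F \<subseteq> E \<Longrightarrow> ((\<lambda>a. mu a F) \<longlongrightarrow> nu F) \<F>"
  shows "((\<lambda>a. Zw E (mu a) (w a)) \<longlongrightarrow> Zw E nu v) \<F>"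
  unfolding Zw_def
  by (intro tendsto_sum tendsto_mult tendsto_prod assms) (use assms in auto)

text \<open>Reduces the comparison of two weight vectors to changes of one coordinate at a time. The
  intermediate vectors stay positive because each change only raises a positive weight.\<close>

lemma override_on_coordinatewise_le:
  fixes Phi :: "('a \<Rightarrow> real) \<Rightarrow> real"
  assumes "finite S" "S \<subseteq> E"
    and step: "\<And>w f y. f \<in> S \<Longrightarrow> \<forall>k\<in>E. 0 < w k \<Longrightarrow> w f \<le> y \<Longrightarrow> Phi (w(f := y)) \<le> Phi w"
    and "\<forall>k\<in>E. 0 < w k" "\<And>k. k \<in> S \<Longrightarrow> w k \<le> w' k"
  shows "Phi (override_on w w' S) \<le> Phi w"
  using assms(1,2) step assms(5)
proof (induction S rule: finite_induct)
  case empty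
  then show ?case by (simp add: override_on_def)
next
  case (insert f S)
  have "override_on w w' (insert f S) = (override_on w w' S)(f := w' f)"
    by (auto simp: override_on_def)
  moreover have "Phi ((override_on w w' S)(f := w' f)) \<le> Phi (override_on w w' S)"
    using insert.prems insert.hyps assms(4)
    by (intro insert.prems(2)) (force simp: override_on_def)+
  moreover have "Phi (override_on w w' S) \<le> Phi w"
    using insert.prems by (intro insert.IH) auto
  ultimately show ?case by (metis order_trans)
qed

locale subset_measure =
  fixes E :: "'a set" and mu :: "'a set \<Rightarrow> real"
  assumes finite_E: "finite E"
    and nonneg: "F \<subseteq> E \<Longrightarrow> 0 \<le> mu F"
    and empty_pos: "0 < mu {}"
begin

text \<open>The term of the empty set alone bounds the sum, which keeps denominators positive even
  at zero weights. The set \<open>D\<close> leaves room for deletions such as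
  \<open>E - {e}\<close>.\<close>

lemma Zw_ge_empty:
  assumes "D \<subseteq> E" "\<And>k. k \<in> D \<Longrightarrow> 0 \<le> w k"
  shows "mu {} \<le> Zw D mu w"
proof -
  have "mu {} * prod w {} \<le> Zw D mu w"
    unfolding Zw_def
  proof (rule member_le_sum[where i = "{}" and f = "\<lambda>F. mu F * prod w F"])
    fix F assume "F \<in> Pow D - {{}}"
    then show "0 \<le> mu F * prod w F"
      using assms by (intro mult_nonneg_nonneg nonneg prod_nonneg) auto
  qed (use assms finite_E finite_subset in auto)
  then show ?thesis by simp
qed

lemma Zw_pos: "D \<subseteq> E \<Longrightarrow> (\<And>k. k \<in> D \<Longrightarrow> 0 \<le> w k) \<Longrightarrow> 0 < Zw D mu w"
  using Zw_ge_empty empty_pos by (metis order_less_le_trans)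

lemma Z_con_nonneg:
  assumes "e \<in> E" "\<And>k. k \<in> E - {e} \<Longrightarrow> 0 \<le> w k"
  shows "0 \<le> Z_con E mu e w"
  unfolding Z_con_def using assms
  by (intro sum_nonneg mult_nonneg_nonneg nonneg prod_nonneg) auto

lemma cavity_ratio_nonneg:
  assumes "e \<in> E" "\<And>k. k \<in> E - {e} \<Longrightarrow> 0 \<le> w k"
  shows "0 \<le> cavity_ratio E mu e w"
  unfolding cavity_ratio_def Z_del_eq_Zw
  using Z_con_nonneg[OF assms] Zw_pos[of "E - {e}" w] assms by (simp add: less_imp_le)

text \<open>The measure varies together with the weights, since matched vertices of nearby networks
  carry local measures that agree only up to a small error.\<close>

lemma tendsto_cavity_ratio:
  assumes "\<And>k. k \<in> E - {e} \<Longrightarrow> ((\<lambda>a. w a k) \<longlongrightarrow> v k) \<F>"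
    and "\<And>F. F \<subseteq> E \<Longrightarrow> ((\<lambda>a. nu a F) \<longlongrightarrow> mu F) \<F>"
    and "e \<in> E" "\<And>k. k \<in> E - {e} \<Longrightarrow> 0 \<le> v k"
  shows "((\<lambda>a. cavity_ratio E (nu a) e (w a)) \<longlongrightarrow> cavity_ratio E mu e v) \<F>"
  unfolding cavity_ratio_def Z_del_eq_Zw Z_con_eq_Zw
  by (intro tendsto_divide tendsto_Zw assms) (use assms finite_E Zw_pos[of "E - {e}" v] in auto)

section \<open>Rayleigh property: cavity ratios decrease in the other weights\<close>

lemma prob_incl_single:
  assumes "e \<in> E"
  shows "prob_incl E mu w {e} = w e * Z_con E mu e w / Zw E mu w"
proof -
  have "prod w (insert e F) = w e * prod w F" if "F \<in> Pow (E - {e})" for F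
    using that finite_E finite_subset[of F E] by (subst prod.insert) auto
  then show ?thesis
    unfolding prob_incl_def Pw_def Z_con_def
    using sum_Pow_containing[OF finite_E assms]
    by (simp add: sum_distrib_left sum_divide_distrib mult_ac)
qed

lemma prob_incl_pair:
  assumes "e \<in> E" "f \<in> E" "e \<noteq> f"
  shows "prob_incl E mu w {e, f} =
    w e * w f * Zw (E - {e} - {f}) (\<lambda>F. mu (insert e (insert f F))) w / Zw E mu w"
proof -
  have fin: "finite (E - {e})" "f \<in> E - {e}" using finite_E assms by auto
  have "prod w (insert e (insert f F)) = w e * (w f * prod w F)" if "F \<in> Pow (E - {e} - {f})" for F
  proof -
    have "finite F" "f \<notin> F" "e \<notin> insert f F"
      using that finite_E assms by (auto intro: finite_subset)
    then show ?thesis by simp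
  qed
  moreover have "(\<Sum>F\<in>{F\<in>Pow E. {e, f} \<subseteq> F}. g F) =
      (\<Sum>F\<in>Pow (E - {e} - {f}). g (insert e (insert f F)))" for g :: "'a set \<Rightarrow> real"
  proof -
    have "(\<Sum>F\<in>{F\<in>Pow E. {e, f} \<subseteq> F}. g F) =
        (\<Sum>F\<in>{F\<in>Pow E. e \<in> F}. if f \<in> F then g F else 0)"
      using finite_E by (subst sum.inter_filter[symmetric]) (auto intro!: sum.cong)
    also have "\<dots> = (\<Sum>F\<in>Pow (E - {e}). if f \<in> F then g (insert e F) else 0)"
      unfolding sum_Pow_containing[OF finite_E assms(1)] using assms by (intro sum.cong) auto
    also have "\<dots> = (\<Sum>F\<in>{F\<in>Pow (E - {e}). f \<in> F}. g (insert e F))"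
      using finite_E by (intro sum.inter_filter[symmetric]) auto
    finally show ?thesis unfolding sum_Pow_containing[OF fin] .
  qed
  ultimately show ?thesis
    unfolding prob_incl_def Pw_def Zw_def[of "E - {e} - {f}"]
    by (simp add: sum_distrib_left sum_divide_distrib mult_ac)
qed

text \<open>With \<open>a = w e\<close>, \<open>b = w f\<close>, the partition function is
  \<open>C + b * G + a * A + a * b * B\<close>. After clearing denominators the Rayleigh inequality
  reads \<open>B * Z \<le> (A + b * B) * (G + a * B)\<close>, and all terms cancel except
  \<open>B * C \<le> A * G\<close>.\<close>

lemma rayleigh_imp_le:
  assumes "rayleigh E mu" "e \<in> E" "f \<in> E" "e \<noteq> f" "\<forall>k\<in>E. 0 < w k"
  defines "D \<equiv> E - {e} - {f}"
  shows "Zw D (\<lambda>F. mu (insert e (insert f F))) w * Zw D mu w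
    \<le> Zw D (\<lambda>F. mu (insert e F)) w * Zw D (\<lambda>F. mu (insert f F)) w"
proof -
  define A B C G where "A = Zw D (\<lambda>F. mu (insert e F)) w"
    and "B = Zw D (\<lambda>F. mu (insert e (insert f F))) w"
    and "C = Zw D mu w" and "G = Zw D (\<lambda>F. mu (insert f F)) w"
  define Z where "Z = Zw E mu w"
  define a b where "a = w e" and "b = w f"
  have ab: "0 < a" "0 < b" using assms by (auto simp: a_def b_def)
  have Zpos: "0 < Z" unfolding Z_def using assms by (intro Zw_pos) (auto intro: less_imp_le)
  have D': "D = E - {f} - {e}" by (auto simp: D_def)
  have fe: "f \<in> E - {e}" "e \<in> E - {f}" using assms by auto
  have con_e: "Z_con E mu e w = A + b * B"
    unfolding Z_con_eq_Zw using Zw_split[OF _ fe(1), of "\<lambda>F. mu (insert e F)" w] finite_E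
    by (simp add: A_def B_def b_def D_def)
  have con_f: "Z_con E mu f w = G + a * B"
    unfolding Z_con_eq_Zw using Zw_split[OF _ fe(2), of "\<lambda>F. mu (insert f F)" w] finite_E
    by (simp add: G_def B_def a_def D' insert_commute)
  have "Z_del E mu e w = C + b * G"
    unfolding Z_del_eq_Zw using Zw_split[OF _ fe(1), of mu w] finite_E
    by (simp add: C_def G_def b_def D_def)
  then have Z: "Z = C + b * G + a * (A + b * B)"
    using Zw_split[OF finite_E assms(2), of mu w] con_e
    by (simp add: Z_def Z_del_eq_Zw Z_con_eq_Zw a_def)
  have "prob_incl E mu w {e, f} \<le> prob_incl E mu w {e} * prob_incl E mu w {f}"
    using assms by (auto simp: rayleigh_def)
  then have "a * b * B / Z \<le> (a * (A + b * B) / Z) * (b * (G + a * B) / Z)"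
    unfolding prob_incl_single[OF assms(2)] prob_incl_single[OF assms(3)]
      prob_incl_pair[OF assms(2-4)] con_e con_f
    by (simp add: B_def D_def a_def b_def Z_def)
  then have "(a * b * B / Z) * (Z * Z) \<le> (a * (A + b * B) / Z) * (b * (G + a * B) / Z) * (Z * Z)"
    using Zpos by (intro mult_right_mono) auto
  then have "a * b * B * Z \<le> a * (A + b * B) * (b * (G + a * B))"
    using Zpos by simp
  then have "(a * b) * (B * Z) \<le> (a * b) * ((A + b * B) * (G + a * B))"
    by (simp only: mult_ac)
  then have "B * Z \<le> (A + b * B) * (G + a * B)"
    using ab by (simp add: mult_le_cancel_left_pos)
  then have "B * C \<le> A * G" unfolding Z by (simp add: algebra_simps)
  then show ?thesis by (simp add: A_def B_def C_def G_def)
qed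

text \<open>As a function of the weight \<open>z\<close> of \<open>f\<close>, the cavity ratio is
  the Moebius map \<open>(A + z * B) / (C + z * G)\<close>, whose direction is decided by the sign
  of \<open>A * G - B * C\<close>.\<close>

lemma cavity_ratio_update_le:
  assumes "rayleigh E mu" "e \<in> E" "f \<in> E - {e}" "\<forall>k\<in>E. 0 < w k" "w f \<le> y"
  shows "cavity_ratio E mu e (w(f := y)) \<le> cavity_ratio E mu e w"
proof -
  define D where "D = E - {e} - {f}"
  define A B C G where "A = Zw D (\<lambda>F. mu (insert e F)) w"
    and "B = Zw D (\<lambda>F. mu (insert e (insert f F))) w"
    and "C = Zw D mu w" and "G = Zw D (\<lambda>F. mu (insert f F)) w"
  have le: "B * C \<le> A * G"
    using rayleigh_imp_le[of e f w] assms by (auto simp: A_def B_def C_def G_def D_def)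
  have upd: "Zw D nu (w(f := z)) = Zw D nu w" for nu z
    by (rule Zw_cong) (auto simp: D_def)
  have con: "Z_con E mu e (w(f := z)) = A + z * B" for z
    unfolding Z_con_eq_Zw using Zw_split[OF _ assms(3), of "\<lambda>F. mu (insert e F)" "w(f := z)"] finite_E
      upd by (simp add: A_def B_def D_def)
  have del: "Z_del E mu e (w(f := z)) = C + z * G" for z
    unfolding Z_del_eq_Zw using Zw_split[OF _ assms(3), of mu "w(f := z)"] finite_E
      upd by (simp add: C_def G_def D_def)
  have pos: "0 < C + z * G" if "0 < z" for z
    unfolding del[symmetric] Z_del_eq_Zw using that assms
    by (intro Zw_pos) (auto intro: less_imp_le)
  have wf: "0 < w f" using assms by auto
  have "cavity_ratio E mu e w = (A + w f * B) / (C + w f * G)"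
    using con[of "w f"] del[of "w f"] by (simp add: cavity_ratio_def)
  moreover have "(A + y * B) / (C + y * G) \<le> (A + w f * B) / (C + w f * G)"
  proof -
    \<comment> \<open>This product is exactly the difference of the two cross products compared
      next.\<close>
    have "0 \<le> (y - w f) * (A * G - B * C)" using le assms by simp
    then have "(A + y * B) * (C + w f * G) \<le> (A + w f * B) * (C + y * G)"
      by (simp add: algebra_simps)
    then show ?thesis using pos[OF wf] pos[of y] wf assms
      by (simp add: divide_le_eq le_divide_eq mult.commute field_simps)
  qed
  ultimately show ?thesis by (simp add: cavity_ratio_def con del)
qed

lemma cavity_ratio_antimono_pos:
  assumes "rayleigh E mu" "e \<in> E" "\<forall>k\<in>E. 0 < w k" "\<And>k. k \<in> E - {e} \<Longrightarrow> w k \<le> w' k"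
  shows "cavity_ratio E mu e w' \<le> cavity_ratio E mu e w"
proof -
  have "cavity_ratio E mu e (override_on w w' (E - {e})) \<le> cavity_ratio E mu e w"
    using assms finite_E
    by (intro override_on_coordinatewise_le[where E = E] cavity_ratio_update_le) auto
  moreover have "cavity_ratio E mu e (override_on w w' (E - {e})) = cavity_ratio E mu e w'"
    by (rule cavity_ratio_cong) (auto simp: override_on_def)
  ultimately show ?thesis by simp
qed

text \<open>Shifting all weights by \<open>d > 0\<close> leads to the case of positive weights, and
  letting \<open>d\<close> tend to 0 gives the boundary case by continuity.\<close>

lemma cavity_ratio_antimono:
  assumes "rayleigh E mu" "e \<in> E"
    and "\<And>k. k \<in> E - {e} \<Longrightarrow> 0 \<le> w k" "\<And>k. k \<in> E - {e} \<Longrightarrow> w k \<le> w' k"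
  shows "cavity_ratio E mu e w' \<le> cavity_ratio E mu e w"
proof (rule tendsto_le)
  \<comment> \<open>The sign of \<open>w e\<close> is unconstrained, but positivity is wanted on all
    of \<open>E\<close> after the shift. The cavity ratio at \<open>e\<close> ignores this
    coordinate, so it may be reset to 0.\<close>
  define v where "v = w(e := 0)"
  show "((\<lambda>d. cavity_ratio E mu e (\<lambda>k. v k + d)) \<longlongrightarrow> cavity_ratio E mu e w) (at_right 0)"
    using assms by (intro tendsto_cavity_ratio) (auto intro!: tendsto_eq_intros simp: v_def)
  show "((\<lambda>d. cavity_ratio E mu e (\<lambda>k. w' k + d)) \<longlongrightarrow> cavity_ratio E mu e w') (at_right 0)"
    using assms(3,4) assms(2) 
    by (intro tendsto_cavity_ratio) (auto intro!: tendsto_eq_intros intro: order_trans)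
  show "\<forall>\<^sub>F d in at_right 0. cavity_ratio E mu e (\<lambda>k. w' k + d) \<le> cavity_ratio E mu e (\<lambda>k. v k + d)"
    using eventually_at_right_less[of 0]
  proof eventually_elim
    case (elim d)
    then show ?case
      using assms by (intro cavity_ratio_antimono_pos) (auto simp: v_def intro: add_nonneg_pos)
  qed
qed simp

section \<open>Size-increasing property: the mean size is strictly increasing in the weights\<close>

lemma exp_size_eq_divide: "exp_size E mu w = Zw E (\<lambda>F. card F * mu F) w / Zw E mu w"
  by (simp add: exp_size_def Zw_def Pw_def sum_divide_distrib mult_ac)

lemma exp_size_incl_eq:
  assumes "e \<in> E"
  shows "exp_size_incl E mu w e =
    w e * Zw (E - {e}) (\<lambda>F. card (insert e F) * mu (insert e F)) w / Zw E mu w"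
proof -
  have "prod w (insert e F) = w e * prod w F" if "F \<in> Pow (E - {e})" for F
    using that finite_E finite_subset[of F E] by (subst prod.insert) auto
  then show ?thesis
    unfolding exp_size_incl_def Pw_def Zw_def[of "E - {e}"]
    using sum_Pow_containing[OF finite_E assms]
    by (simp add: sum_distrib_left sum_divide_distrib mult_ac)
qed

text \<open>Splitting on \<open>e\<close> gives \<open>Z = C + w e * G\<close> and the size-weighted
  sum \<open>P + w e * Q\<close>. The hypothesis becomes \<open>(P + w e * Q) * G < Q * Z\<close>,
  where the terms \<open>w e * Q * G\<close> cancel.\<close>

lemma size_increasing_imp_less:
  assumes "size_increasing E mu" "e \<in> E" "\<forall>k\<in>E. 0 < w k"
  defines "D \<equiv> E - {e}"
  shows "Zw D (\<lambda>F. card F * mu F) w * Zw D (\<lambda>F. mu (insert e F)) w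
    < Zw D (\<lambda>F. card (insert e F) * mu (insert e F)) w * Zw D mu w"
proof -
  define P Q C G where "P = Zw D (\<lambda>F. card F * mu F) w"
    and "Q = Zw D (\<lambda>F. card (insert e F) * mu (insert e F)) w"
    and "C = Zw D mu w" and "G = Zw D (\<lambda>F. mu (insert e F)) w"
  define Z where "Z = Zw E mu w"
  have a: "0 < w e" using assms by auto
  have Zpos: "0 < Z" unfolding Z_def using assms by (intro Zw_pos) (auto intro: less_imp_le)
  have Z: "Z = C + w e * G"
    using Zw_split[OF finite_E assms(2), of mu w] by (simp add: Z_def C_def G_def D_def)
  have N: "Zw E (\<lambda>F. card F * mu F) w = P + w e * Q"
    using Zw_split[OF finite_E assms(2), of "\<lambda>F. card F * mu F" w] by (simp add: P_def Q_def D_def)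
  have "exp_size E mu w * prob_incl E mu w {e} < exp_size_incl E mu w e"
    using assms by (auto simp: size_increasing_def)
  then have "((P + w e * Q) / Z) * (w e * G / Z) < w e * Q / Z"
    unfolding exp_size_eq_divide prob_incl_single[OF assms(2)] exp_size_incl_eq[OF assms(2)] N
    by (simp add: Z_con_eq_Zw Q_def G_def D_def Z_def)
  then have "((P + w e * Q) / Z) * (w e * G / Z) * (Z * Z) < w e * Q / Z * (Z * Z)"
    using Zpos by (intro mult_strict_right_mono) auto
  then have "(P + w e * Q) * (w e * G) < w e * Q * Z"
    using Zpos by simp
  then have "w e * ((P + w e * Q) * G) < w e * (Q * Z)"
    by (simp only: mult_ac)
  then have "(P + w e * Q) * G < Q * Z"
    using a by (simp add: mult_less_cancel_left_pos)
  then have "P * G < Q * C" unfolding Z by (simp add: algebra_simps)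
  then show ?thesis by (simp add: P_def Q_def C_def G_def)
qed

text \<open>The mean size is \<open>(P + z * Q) / (C + z * G)\<close> in the weight \<open>z\<close>
  of \<open>e\<close>, and its determinant \<open>Q * C - P * G\<close> is positive.\<close>

lemma exp_size_update_less:
  assumes "size_increasing E mu" "e \<in> E" "\<forall>k\<in>E. 0 < w k" "w e < y"
  shows "exp_size E mu w < exp_size E mu (w(e := y))"
proof -
  define D where "D = E - {e}"
  define P Q C G where "P = Zw D (\<lambda>F. card F * mu F) w"
    and "Q = Zw D (\<lambda>F. card (insert e F) * mu (insert e F)) w"
    and "C = Zw D mu w" and "G = Zw D (\<lambda>F. mu (insert e F)) w"
  have less: "P * G < Q * C"
    using size_increasing_imp_less[of e w] assms by (auto simp: P_def Q_def C_def G_def D_def)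
  have upd: "Zw D nu (w(e := z)) = Zw D nu w" for nu z
    by (rule Zw_cong) (auto simp: D_def)
  have Z: "Zw E mu (w(e := z)) = C + z * G" for z
    using Zw_split[OF finite_E assms(2), of mu "w(e := z)"] upd by (simp add: C_def G_def D_def)
  have N: "Zw E (\<lambda>F. card F * mu F) (w(e := z)) = P + z * Q" for z
    using Zw_split[OF finite_E assms(2), of "\<lambda>F. card F * mu F" "w(e := z)"] upd
    by (simp add: P_def Q_def D_def)
  have pos: "0 < C + z * G" if "0 < z" for z
    unfolding Z[symmetric] using that assms by (intro Zw_pos) (auto intro: less_imp_le)
  have we: "0 < w e" using assms by auto
  have "exp_size E mu w = (P + w e * Q) / (C + w e * G)"
    using N[of "w e"] Z[of "w e"] by (simp add: exp_size_eq_divide)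
  moreover have "(P + w e * Q) / (C + w e * G) < (P + y * Q) / (C + y * G)"
  proof -
    have "0 < (y - w e) * (Q * C - P * G)" using less assms by simp
    then have "(P + w e * Q) * (C + y * G) < (P + y * Q) * (C + w e * G)"
      by (simp add: algebra_simps)
    then show ?thesis using pos[OF we] pos[of y] we assms
      by (simp add: divide_less_eq less_divide_eq mult.commute field_simps)
  qed
  ultimately show ?thesis by (simp add: exp_size_eq_divide N Z)
qed

lemma exp_size_cong: "(\<And>k. k \<in> E \<Longrightarrow> w k = w' k) \<Longrightarrow> exp_size E mu w = exp_size E mu w'"
  unfolding exp_size_eq_divide using Zw_cong[of E w w'] by simp

lemma exp_size_mono:
  assumes "size_increasing E mu" "\<forall>k\<in>E. 0 < w k" "\<And>k. k \<in> E \<Longrightarrow> w k \<le> w' k"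
  shows "exp_size E mu w \<le> exp_size E mu w'"
proof -
  \<comment> \<open>The coordinatewise principle is stated for decreasing functionals, hence the
    sign.\<close>
  have "- exp_size E mu (override_on w w' E) \<le> - exp_size E mu w"
  proof (rule override_on_coordinatewise_le[where E = E])
    fix v f and y :: real assume "f \<in> E" "\<forall>k\<in>E. 0 < v k" "v f \<le> y"
    then show "- exp_size E mu (v(f := y)) \<le> - exp_size E mu v"
      using exp_size_update_less[OF assms(1), of f v y] by (cases "v f = y") auto
  qed (use assms finite_E in auto)
  moreover have "exp_size E mu (override_on w w' E) = exp_size E mu w'"
    by (rule exp_size_cong) auto
  ultimately show ?thesis by simp
qed

lemma exp_size_strict_mono:
  assumes "size_increasing E mu" "\<forall>k\<in>E. 0 < w k" "\<And>k. k \<in> E \<Longrightarrow> w k \<le> w' k"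
    and "f \<in> E" "w f < w' f"
  shows "exp_size E mu w < exp_size E mu w'"
proof -
  have "exp_size E mu w < exp_size E mu (w(f := w' f))"
    using assms by (intro exp_size_update_less) auto
  also have "\<dots> \<le> exp_size E mu w'"
    using assms by (intro exp_size_mono) (auto intro: less_trans)
  finally show ?thesis .
qed

section \<open>Positivity, edge marginals and the rank bound\<close>

text \<open>If \<open>mu {e} = 0\<close>, the cavity ratio at \<open>e\<close> vanishes for zero
  weights, hence by antitonicity also for unit weights. Then every set containing \<open>e\<close>
  has measure 0, and the strict inequality from size-increase degenerates to
  \<open>0 < 0\<close>.\<close>

lemma singleton_pos:
  assumes "rayleigh E mu" "size_increasing E mu" "e \<in> E"
  shows "0 < mu {e}"
proof (rule ccontr)
  assume "\<not> 0 < mu {e}"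
  then have mu0: "mu {e} = 0" using nonneg[of "{e}"] assms by auto
  let ?one = "\<lambda>_. 1 :: real"
  have "Z_con E mu e (\<lambda>_. 0) = 0"
    unfolding Z_con_def
  proof (rule sum.neutral, rule ballI)
    fix F assume "F \<in> Pow (E - {e})"
    then show "mu (insert e F) * (\<Prod>_\<in>F. 0) = 0"
      using mu0 finite_E finite_subset[of F "E - {e}"] by (cases "F = {}") (auto simp: card_eq_0_iff)
  qed
  then have "cavity_ratio E mu e ?one \<le> 0"
    using cavity_ratio_antimono[OF assms(1,3), of "\<lambda>_. 0" ?one] by (simp add: cavity_ratio_def)
  moreover have "0 < Z_del E mu e ?one" unfolding Z_del_eq_Zw by (intro Zw_pos) auto
  ultimately have "Z_con E mu e ?one \<le> 0"
    by (simp add: cavity_ratio_def divide_le_0_iff)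
  then have Z0: "Z_con E mu e ?one = 0" using Z_con_nonneg[of e ?one] assms by auto
  then have "mu (insert e F) = 0" if "F \<in> Pow (E - {e})" for F
    using that finite_E assms(3) unfolding Z_con_def
    by (subst (asm) sum_nonneg_eq_0_iff) (auto intro: nonneg)
  then have "Zw (E - {e}) (\<lambda>F. card (insert e F) * mu (insert e F)) ?one = 0"
    unfolding Zw_def by (intro sum.neutral) auto
  then show False
    using size_increasing_imp_less[OF assms(2,3), of ?one] Z0 by (simp add: Z_con_eq_Zw)
qed

lemma cavity_ratio_pos:
  assumes "rayleigh E mu" "size_increasing E mu" "e \<in> E" "\<And>k. k \<in> E - {e} \<Longrightarrow> 0 \<le> w k"
  shows "0 < cavity_ratio E mu e w"
proof -
  have "mu (insert e {}) * prod w {} \<le> Z_con E mu e w"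
    unfolding Z_con_def
  proof (rule member_le_sum[where i = "{}" and f = "\<lambda>F. mu (insert e F) * prod w F"])
    fix F assume "F \<in> Pow (E - {e}) - {{}}"
    then show "0 \<le> mu (insert e F) * prod w F"
      using assms(3,4) by (intro mult_nonneg_nonneg nonneg prod_nonneg) auto
  qed (use finite_E in auto)
  then have "0 < Z_con E mu e w" using singleton_pos[OF assms(1-3)] by simp
  then show ?thesis
    unfolding cavity_ratio_def Z_del_eq_Zw using Zw_pos[of "E - {e}" w] assms by simp
qed

text \<open>The product \<open>w e * cavity_ratio E mu e w\<close> is the odds of \<open>e\<close>
  being in the random set, and \<open>x / (1 + x)\<close> turns odds into a probability. Summing the
  marginals gives the mean size.\<close>

lemma exp_size_eq_sum_cavity:
  assumes "\<And>k. k \<in> E \<Longrightarrow> 0 \<le> w k"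
  shows "exp_size E mu w =
    (\<Sum>e\<in>E. w e * cavity_ratio E mu e w / (1 + w e * cavity_ratio E mu e w))"
proof -
  have "exp_size E mu w = (\<Sum>F\<in>Pow E. \<Sum>e\<in>E. if e \<in> F then Pw E mu w F else 0)"
    unfolding exp_size_def
  proof (rule sum.cong)
    fix F assume "F \<in> Pow E"
    then have "E \<inter> F = F" by auto
    then show "real (card F) * Pw E mu w F = (\<Sum>e\<in>E. if e \<in> F then Pw E mu w F else 0)"
      using finite_E by (simp add: sum.inter_restrict[symmetric])
  qed simp
  also have "\<dots> = (\<Sum>e\<in>E. \<Sum>F\<in>Pow E. if e \<in> F then Pw E mu w F else 0)"
    by (rule sum.swap)
  also have "\<dots> = (\<Sum>e\<in>E. prob_incl E mu w {e})"
    unfolding prob_incl_def using finite_E by (subst sum.inter_filter) auto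
  also have "\<dots> = (\<Sum>e\<in>E. w e * cavity_ratio E mu e w / (1 + w e * cavity_ratio E mu e w))"
  proof (rule sum.cong)
    fix e assume e: "e \<in> E"
    have "0 < Z_del E mu e w" unfolding Z_del_eq_Zw using assms by (intro Zw_pos) auto
    moreover have "Zw E mu w = Z_del E mu e w + w e * Z_con E mu e w"
      using Zw_split[OF finite_E e] by (simp add: Z_del_eq_Zw Z_con_eq_Zw)
    moreover have "0 \<le> w e * Z_con E mu e w" using e assms Z_con_nonneg by auto
    ultimately show "prob_incl E mu w {e} =
        w e * cavity_ratio E mu e w / (1 + w e * cavity_ratio E mu e w)"
      unfolding prob_incl_single[OF e] cavity_ratio_def by (simp add: field_simps)
  qed simp
  finally show ?thesis .
qed

lemma exp_size_le_rank:
  assumes "\<And>k. k \<in> E \<Longrightarrow> 0 \<le> w k"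
  shows "exp_size E mu w \<le> rank_of E mu"
proof -
  have "Zw E (\<lambda>F. card F * mu F) w \<le> rank_of E mu * Zw E mu w"
    unfolding Zw_def sum_distrib_left
  proof (rule sum_mono)
    fix F assume F: "F \<in> Pow E"
    then have p: "0 \<le> prod w F" using assms by (intro prod_nonneg) auto
    have "card F * mu F \<le> rank_of E mu * mu F"
    proof (cases "0 < mu F")
      case True
      then have "card F \<le> rank_of E mu"
        unfolding rank_of_def using F finite_E by (intro Max_ge) auto
      then show ?thesis using True by simp
    next
      case False
      then have "mu F = 0" using nonneg[of F] F by auto
      then show ?thesis by simp
    qed
    from mult_right_mono[OF this p]
    show "card F * mu F * prod w F \<le> rank_of E mu * (mu F * prod w F)" by (simp add: mult_ac)
  qed
  then show ?thesis
    unfolding exp_size_eq_divide using Zw_pos[of E w] assms by (simp add: pos_divide_le_eq)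
qed

end

section \<open>Sandwiching the iterates of the cavity map\<close>

lemma wf_networkD:
  assumes "wf_network N"
  shows "adj N i j \<Longrightarrow> i \<in> verts N" "adj N i j \<Longrightarrow> j \<in> verts N" "adj N i j \<Longrightarrow> adj N j i"
    "\<not> adj N i i" "i \<in> verts N \<Longrightarrow> finite (nbrs N i)" "0 \<le> lm N i F"
  using assms by (auto simp: wf_network_def)

lemma mem_nbrs_iff [simp]: "j \<in> nbrs N i \<longleftrightarrow> adj N i j"
  by (simp add: nbrs_def)

lemma subset_measure_lm:
  assumes "wf_network N" "i \<in> verts N" "0 < lm N i {}"
  shows "subset_measure (nbrs N i) (lm N i)"
  using assms wf_networkD by (simp add: subset_measure_def)

text \<open>The guard replaces the junk value of the cavity ratio at vertices with \<open>\<mu>\<^sub>i(\<emptyset>) = 0\<close>,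
  so that the messages depend continuously on an arbitrary network.\<close>

primrec msg :: "real \<Rightarrow> network \<Rightarrow> nat \<Rightarrow> nat \<Rightarrow> nat \<Rightarrow> real" where
  "msg t N 0 = (\<lambda>i j. 0)"
| "msg t N (Suc n) = (\<lambda>i j. if 0 < lm N i {} then cav_map N t (msg t N n) i j else 0)"

lemma cav_map_nonneg:
  assumes "wf_network N" "0 \<le> t" "0 < lm N i {}" "x \<in> config N"
  shows "0 \<le> cav_map N t x i j"
proof (cases "adj N i j")
  case True
  interpret subset_measure "nbrs N i" "lm N i"
    using assms True wf_networkD(1) by (intro subset_measure_lm) auto
  have "0 \<le> cavity_ratio (nbrs N i) (lm N i) j (\<lambda>k. x k i)"
    using True assms wf_networkD(3) by (intro cavity_ratio_nonneg) (auto simp: config_def)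
  then show ?thesis using assms True by (simp add: cav_map_def cavity_op_def)
qed (simp add: cav_map_def cavity_op_def)

lemma msg_config: "wf_network N \<Longrightarrow> 0 \<le> t \<Longrightarrow> msg t N n \<in> config N"
proof (induction n)
  case (Suc n)
  then show ?case
    using cav_map_nonneg[of N t _ "msg t N n"]
    by (auto simp: config_def) (simp add: cav_map_def cavity_op_def)
qed (simp add: config_def)

lemma config_nonneg: "x \<in> config N \<Longrightarrow> 0 \<le> x i j"
  by (cases "adj N i j") (auto simp: config_def)

locale monotone_network =
  fixes N :: network and t :: real
  assumes wf: "wf_network N" and monotone: "cavity_monotone_network N" and t_pos: "0 < t"
begin

lemma local_measure:
  assumes "i \<in> verts N"
  shows "subset_measure (nbrs N i) (lm N i)" "rayleigh (nbrs N i) (lm N i)"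
    "size_increasing (nbrs N i) (lm N i)" "0 < lm N i {}"
  using monotone assms wf
  by (auto simp: cavity_monotone_network_def cavity_monotone_def intro!: subset_measure_lm)

text \<open>The guard changes nothing here: it holds at every vertex of a cavity-monotone network,
  and off the vertex set the cavity map is 0 anyway.\<close>

lemma msg_eq_funpow: "msg t N n = (cav_map N t ^^ n) (\<lambda>_ _. 0)"
proof (induction n)
  case (Suc n)
  have "cav_map N t x i j = 0" if "\<not> 0 < lm N i {}" for x i j
    using that local_measure(4)[of i] wf_networkD(1)[OF wf]
    by (auto simp: cav_map_def cavity_op_def)
  then have "msg t N (Suc n) = cav_map N t (msg t N n)" by (auto simp: fun_eq_iff)
  with Suc show ?case by simp
qed simp

lemma cav_map_config:
  assumes "x \<in> config N"
  shows "cav_map N t x \<in> config N"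
proof -
  have "0 \<le> cav_map N t x i j" if "adj N i j" for i j
    using that assms t_pos wf local_measure(4)[of i] wf_networkD(1)[OF wf that]
    by (intro cav_map_nonneg) auto
  then show ?thesis by (auto simp: config_def) (simp add: cav_map_def cavity_op_def)
qed

lemma funpow_cav_map_config: "x \<in> config N \<Longrightarrow> (cav_map N t ^^ n) x \<in> config N"
  by (induction n) (auto intro: cav_map_config)

lemma cav_map_antimono:
  assumes "x \<in> config N" "x \<le> y"
  shows "cav_map N t y \<le> cav_map N t x"
proof (intro le_funI)
  fix i j
  show "cav_map N t y i j \<le> cav_map N t x i j"
  proof (cases "adj N i j")
    case True
    then have "i \<in> verts N" using wf_networkD[OF wf] by blast
    then show ?thesis
      using True assms t_pos subset_measure.cavity_ratio_antimono[OF local_measure(1,2)]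
      by (auto simp: cav_map_def cavity_op_def le_fun_def config_nonneg intro!: mult_left_mono)
  qed (simp add: cav_map_def cavity_op_def)
qed

lemma cav_map_pos:
  assumes "x \<in> config N" "adj N i j"
  shows "0 < cav_map N t x i j"
proof -
  have "i \<in> verts N" using assms wf_networkD[OF wf] by blast
  from subset_measure.cavity_ratio_pos[OF local_measure(1-3)[OF this], of j "\<lambda>k. x k i"]
  show ?thesis using assms t_pos by (simp add: cav_map_def cavity_op_def config_nonneg)
qed

lemma msg_in_config: "msg t N n \<in> config N"
  using msg_config[OF wf] t_pos by simp

lemma msg_Suc: "msg t N (Suc n) = cav_map N t (msg t N n)"
  by (simp only: msg_eq_funpow funpow.simps o_apply)

section \<open>Bounds valid for all trajectories, and the limits of the bounds\<close>

text \<open>Zero lies below every configuration, and each application of an antitone map turns a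
  lower bound into an upper one and back. So the two bounds have to be carried through the induction
  together.\<close>

lemma msg_sandwich_aux:
  assumes "x \<in> config N"
  shows "msg t N (2 * n) \<le> (cav_map N t ^^ (2 * n)) x \<and>
    (cav_map N t ^^ Suc (2 * n)) x \<le> msg t N (Suc (2 * n))"
proof (induction n)
  case 0
  have *: "msg t N 0 \<le> x" using assms by (auto simp: le_fun_def config_nonneg)
  from cav_map_antimono[OF msg_in_config *] * show ?case
    by (simp add: msg_Suc del: msg.simps(2))
next
  case (Suc n)
  have 1: "msg t N (Suc (Suc (2 * n))) \<le> (cav_map N t ^^ (Suc (Suc (2 * n)))) x"
    using cav_map_antimono[OF funpow_cav_map_config[OF assms] conjunct2[OF Suc]]
    by (simp add: msg_Suc del: msg.simps(2))
  from cav_map_antimono[OF msg_in_config 1] 1 show ?case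
    by (simp add: msg_Suc del: msg.simps(2))
qed

text \<open>The first \<open>m - 2 * n\<close> steps are absorbed into the initial configuration, as
  the sandwich holds for any start. This makes the bound valid for \<open>m\<close> of either
  parity.\<close>

lemma msg_even_le:
  assumes "x \<in> config N" "2 * n \<le> m"
  shows "msg t N (2 * n) \<le> (cav_map N t ^^ m) x"
proof -
  have "(cav_map N t ^^ m) x = (cav_map N t ^^ (2 * n)) ((cav_map N t ^^ (m - 2 * n)) x)"
    using assms by (metis funpow_add le_add_diff_inverse o_apply)
  then show ?thesis using msg_sandwich_aux[OF funpow_cav_map_config[OF assms(1)]] by simp
qed

lemma msg_odd_ge:
  assumes "x \<in> config N" "Suc (2 * n) \<le> m"
  shows "(cav_map N t ^^ m) x \<le> msg t N (Suc (2 * n))"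
proof -
  have "(cav_map N t ^^ m) x =
      (cav_map N t ^^ Suc (2 * n)) ((cav_map N t ^^ (m - Suc (2 * n))) x)"
    using assms by (metis funpow_add le_add_diff_inverse o_apply)
  then show ?thesis using msg_sandwich_aux[OF funpow_cav_map_config[OF assms(1)]] by metis
qed

lemma zero_config: "(\<lambda>_ _. 0) \<in> config N"
  by (simp add: config_def)

definition lo :: "nat \<Rightarrow> nat \<Rightarrow> real" where
  "lo i j = lim (\<lambda>n. msg t N (2 * n) i j)"

definition hi :: "nat \<Rightarrow> nat \<Rightarrow> real" where
  "hi i j = lim (\<lambda>n. msg t N (Suc (2 * n)) i j)"

lemma msg_even_mono: "n \<le> m \<Longrightarrow> msg t N (2 * n) i j \<le> msg t N (2 * m) i j"
  using msg_even_le[OF zero_config, of n "2 * m"] by (simp add: msg_eq_funpow le_fun_def)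

lemma msg_odd_mono: "n \<le> m \<Longrightarrow> msg t N (Suc (2 * m)) i j \<le> msg t N (Suc (2 * n)) i j"
  using msg_odd_ge[OF zero_config, of n "Suc (2 * m)"]
  unfolding msg_eq_funpow le_fun_def by simp

lemma msg_even_le_odd: "msg t N (2 * n) i j \<le> msg t N (Suc (2 * m)) i j"
proof -
  have "msg t N (2 * n) i j \<le> msg t N (2 * max n m) i j" by (rule msg_even_mono) simp
  also have "\<dots> \<le> msg t N (Suc (2 * max n m)) i j"
    using msg_even_le[OF zero_config, of "max n m" "Suc (2 * max n m)"]
    unfolding msg_eq_funpow le_fun_def by simp
  also have "\<dots> \<le> msg t N (Suc (2 * m)) i j" by (rule msg_odd_mono) simp
  finally show ?thesis .
qed

lemma tendsto_lo: "(\<lambda>n. msg t N (2 * n) i j) \<longlonglongrightarrow> lo i j"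
proof -
  have "convergent (\<lambda>n. msg t N (2 * n) i j)"
  proof (rule Bseq_mono_convergent)
    have "0 \<le> msg t N (2 * n) i j" "msg t N (2 * n) i j \<le> msg t N (Suc (2 * 0)) i j" for n
      using config_nonneg[OF msg_in_config] msg_even_le_odd by blast+
    then show "Bseq (\<lambda>n. msg t N (2 * n) i j)"
      by (intro BseqI'[where K = "msg t N (Suc (2 * 0)) i j"]) simp
  qed (use msg_even_mono in blast)
  then show ?thesis unfolding lo_def by (simp add: convergent_LIMSEQ_iff)
qed

lemma tendsto_hi: "(\<lambda>n. msg t N (Suc (2 * n)) i j) \<longlonglongrightarrow> hi i j"
proof -
  have "convergent (\<lambda>n. - msg t N (Suc (2 * n)) i j)"
  proof (rule Bseq_mono_convergent)
    have "0 \<le> msg t N (Suc (2 * n)) i j" "msg t N (Suc (2 * n)) i j \<le> msg t N (Suc (2 * 0)) i j" for n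
      using config_nonneg[OF msg_in_config] msg_odd_mono[of 0] by blast+
    then show "Bseq (\<lambda>n. - msg t N (Suc (2 * n)) i j)"
      by (intro BseqI'[where K = "msg t N (Suc (2 * 0)) i j"]) simp
  qed (use msg_odd_mono in auto)
  then show ?thesis unfolding hi_def by (simp add: convergent_minus_iff[symmetric] convergent_LIMSEQ_iff)
qed

lemma msg_even_le_lo: "msg t N (2 * n) i j \<le> lo i j"
  using msg_even_mono by (intro LIMSEQ_le_const[OF tendsto_lo]) blast

lemma lo_le_hi: "lo i j \<le> hi i j"
  using msg_even_le_odd by (intro LIMSEQ_le[OF tendsto_lo tendsto_hi]) blast

lemma lo_nonneg: "0 \<le> lo i j"
  using msg_even_le_lo[of 0] by simp

text \<open>The cavity map sends every configuration to one that is positive on oriented edges.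
  Iterate 0 is zero, so 2 is the first even index at which this shows.\<close>

lemma lo_pos:
  assumes "adj N i j"
  shows "0 < lo i j"
proof -
  have "0 < msg t N (2 * 1) i j"
    using cav_map_pos[OF msg_in_config assms, of 1] unfolding msg_Suc[symmetric] by (simp add: numeral_2_eq_2)
  also have "\<dots> \<le> lo i j" by (rule msg_even_le_lo)
  finally show ?thesis .
qed

lemma tendsto_cav_map:
  assumes "\<And>i j. ((\<lambda>n. x n i j) \<longlongrightarrow> y i j) \<F>" "\<And>i j. 0 \<le> y i j"
  shows "((\<lambda>n. cav_map N t (x n) i j) \<longlongrightarrow> cav_map N t y i j) \<F>"
proof (cases "adj N i j")
  case True
  then have "i \<in> verts N" using wf_networkD[OF wf] by blast
  from subset_measure.tendsto_cavity_ratio[OF local_measure(1)[OF this], of j "\<lambda>n k. x n k i" "\<lambda>k. y k i" \<F> "\<lambda>_. lm N i"]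
  show ?thesis using True assms
    by (simp add: cav_map_def cavity_op_def tendsto_mult_left)
qed (simp add: cav_map_def cavity_op_def)

lemma cav_map_lo: "cav_map N t lo = hi"
proof (intro ext)
  fix i j
  have "(\<lambda>n. msg t N (Suc (2 * n)) i j) \<longlonglongrightarrow> cav_map N t lo i j"
    unfolding msg_Suc by (rule tendsto_cav_map[OF tendsto_lo lo_nonneg])
  then show "cav_map N t lo i j = hi i j" using tendsto_hi LIMSEQ_unique by blast
qed

lemma cav_map_hi: "cav_map N t hi = lo"
proof (intro ext)
  fix i j
  have "(\<lambda>n. msg t N (2 * Suc n) i j) \<longlonglongrightarrow> cav_map N t hi i j"
    using tendsto_cav_map[OF tendsto_hi order_trans[OF lo_nonneg lo_le_hi]]
    by (simp add: msg_Suc del: msg.simps(2))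
  moreover have "(\<lambda>n. msg t N (2 * Suc n) i j) \<longlonglongrightarrow> lo i j"
    using LIMSEQ_Suc[OF tendsto_lo] .
  ultimately show "cav_map N t hi i j = lo i j" using LIMSEQ_unique by blast
qed

section \<open>Mean size at a vertex under the two limits\<close>

lemma exp_size_eq_sum_cav_map:
  assumes "r \<in> verts N" "\<And>i j. 0 \<le> x i j"
  shows "exp_size (nbrs N r) (lm N r) (\<lambda>k. x k r) =
    (\<Sum>i\<in>nbrs N r. x i r * cav_map N t x r i / (t + x i r * cav_map N t x r i))"
proof -
  interpret subset_measure "nbrs N r" "lm N r" using local_measure assms by blast
  have "exp_size (nbrs N r) (lm N r) (\<lambda>k. x k r) = (\<Sum>i\<in>nbrs N r.
      x i r * cavity_ratio (nbrs N r) (lm N r) i (\<lambda>k. x k r) /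
      (1 + x i r * cavity_ratio (nbrs N r) (lm N r) i (\<lambda>k. x k r)))"
    by (rule exp_size_eq_sum_cavity) (use assms in auto)
  also have "\<dots> = (\<Sum>i\<in>nbrs N r. x i r * cav_map N t x r i / (t + x i r * cav_map N t x r i))"
  proof (rule sum.cong)
    fix i assume "i \<in> nbrs N r"
    then have "cav_map N t x r i = t * cavity_ratio (nbrs N r) (lm N r) i (\<lambda>k. x k r)"
      by (simp add: cav_map_def cavity_op_def)
    moreover have "a * c / (1 + a * c) = a * (t * c) / (t + a * (t * c))" for a c
    proof -
      have "a * (t * c) / (t + a * (t * c)) = (t * (a * c)) / (t * (1 + a * c))"
        by (simp add: algebra_simps)
      then show ?thesis using t_pos by simp
    qed
    ultimately show "x i r * cavity_ratio (nbrs N r) (lm N r) i (\<lambda>k. x k r) /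
      (1 + x i r * cavity_ratio (nbrs N r) (lm N r) i (\<lambda>k. x k r)) =
      x i r * cav_map N t x r i / (t + x i r * cav_map N t x r i)" by simp
  qed simp
  finally show ?thesis .
qed

text \<open>In \<open>hi\<close>, the message out of the vertex is \<open>lo r i\<close>, because
  \<open>cav_map N t hi = lo\<close>. This is what makes the second sum the first one with the
  endpoints of each edge exchanged.\<close>

lemma sum_lo_hi_eq_exp_size:
  assumes "r \<in> verts N"
  shows "(\<Sum>i\<in>nbrs N r. lo i r * hi r i / (t + lo i r * hi r i)) =
      exp_size (nbrs N r) (lm N r) (\<lambda>k. lo k r)"
    and "(\<Sum>i\<in>nbrs N r. lo r i * hi i r / (t + lo r i * hi i r)) =
      exp_size (nbrs N r) (lm N r) (\<lambda>k. hi k r)"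
  using exp_size_eq_sum_cav_map[OF assms, of lo] exp_size_eq_sum_cav_map[OF assms, of hi]
    lo_nonneg order_trans[OF lo_nonneg lo_le_hi]
  by (auto simp: cav_map_lo cav_map_hi mult.commute)

lemma exp_size_lo_le_hi:
  assumes "r \<in> verts N"
  shows "exp_size (nbrs N r) (lm N r) (\<lambda>k. lo k r) \<le> exp_size (nbrs N r) (lm N r) (\<lambda>k. hi k r)"
  using assms lo_pos lo_le_hi wf_networkD(3)[OF wf]
  by (intro subset_measure.exp_size_mono[OF local_measure(1,3)]) auto

lemma exp_size_hi_le_rank:
  assumes "r \<in> verts N"
  shows "exp_size (nbrs N r) (lm N r) (\<lambda>k. hi k r) \<le> rank_of (nbrs N r) (lm N r)"
  using assms order_trans[OF lo_nonneg lo_le_hi]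
  by (intro subset_measure.exp_size_le_rank local_measure) auto

lemma lo_eq_hi_if_exp_size_eq:
  assumes "exp_size (nbrs N r) (lm N r) (\<lambda>k. lo k r) = exp_size (nbrs N r) (lm N r) (\<lambda>k. hi k r)"
    and "adj N r i"
  shows "lo i r = hi i r"
proof (rule ccontr)
  assume "lo i r \<noteq> hi i r"
  then have "lo i r < hi i r" using lo_le_hi[of i r] by simp
  moreover have "r \<in> verts N" using assms wf_networkD(1)[OF wf] by blast
  ultimately have "exp_size (nbrs N r) (lm N r) (\<lambda>k. lo k r) < exp_size (nbrs N r) (lm N r) (\<lambda>k. hi k r)"
    using assms(2) lo_pos lo_le_hi wf_networkD(3)[OF wf]
    by (intro subset_measure.exp_size_strict_mono[OF local_measure(1,3), where f = i]) auto
  then show False using assms(1) by simp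
qed

lemma tendsto_funpow_cav_map:
  assumes "lo i j = hi i j" "x \<in> config N"
  shows "(\<lambda>n. (cav_map N t ^^ n) x i j) \<longlonglongrightarrow> lo i j"
proof (rule tendsto_sandwich)
  \<comment> \<open>For \<open>m \<ge> 1\<close> this is the largest \<open>h\<close> with
    \<open>Suc (2 * h) \<le> m\<close>, so that the even and the odd bound of index \<open>h\<close>
    both apply at time \<open>m\<close>.\<close>
  let ?h = "\<lambda>m::nat. (m - 1) div 2"
  have h: "filterlim ?h sequentially sequentially"
    unfolding filterlim_at_top
  proof
    fix Z
    show "\<forall>\<^sub>F m in sequentially. Z \<le> ?h m"
      using eventually_ge_at_top[of "Suc (2 * Z)"] by eventually_elim linarith
  qed
  show "(\<lambda>m. msg t N (2 * ?h m) i j) \<longlonglongrightarrow> lo i j"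
    by (rule filterlim_compose[OF tendsto_lo h])
  show "(\<lambda>m. msg t N (Suc (2 * ?h m)) i j) \<longlonglongrightarrow> lo i j"
    unfolding assms(1) by (rule filterlim_compose[OF tendsto_hi h])
  have "\<forall>\<^sub>F m::nat in sequentially. Suc (2 * ?h m) \<le> m"
    using eventually_ge_at_top[of "1::nat"] by eventually_elim linarith
  then show "\<forall>\<^sub>F m in sequentially. msg t N (2 * ?h m) i j \<le> (cav_map N t ^^ m) x i j"
    and "\<forall>\<^sub>F m in sequentially. (cav_map N t ^^ m) x i j \<le> msg t N (Suc (2 * ?h m)) i j"
    using msg_even_le[OF assms(2)] msg_odd_ge[OF assms(2)] unfolding le_fun_def
    by (auto elim!: eventually_mono simp del: msg.simps)
qed

lemma globally_attractive_solution:
  assumes eq: "\<And>i j. adj N i j \<Longrightarrow> lo i j = hi i j"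
  shows "\<exists>x\<in>config N. cav_map N t x = x \<and>
       (\<forall>y\<in>config N. cav_map N t y = y \<longrightarrow> y = x) \<and>
       (\<forall>x0\<in>config N. \<forall>i j. adj N i j \<longrightarrow> (\<lambda>n. ((cav_map N t) ^^ n) x0 i j) \<longlonglongrightarrow> x i j)"
proof (intro bexI conjI ballI allI impI)
  have off: "lo i j = 0" "hi i j = 0" if "\<not> adj N i j" for i j
    using that msg_in_config unfolding lo_def hi_def config_def by (auto simp del: msg.simps)
  then have "lo = hi" using eq by (intro ext) metis
  then show fixed: "cav_map N t lo = lo" using cav_map_lo by simp
  show "lo \<in> config N" using off lo_nonneg by (auto simp: config_def)
  fix y assume y: "y \<in> config N"
  show "(\<lambda>n. ((cav_map N t) ^^ n) y i j) \<longlonglongrightarrow> lo i j" if "adj N i j" for i j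
    using tendsto_funpow_cav_map[OF eq[OF that] y] .
  assume fy: "cav_map N t y = y"
  have pow: "(cav_map N t ^^ n) y = y" for n by (induction n) (simp_all add: fy)
  show "y = lo"
  proof (intro ext)
    fix i j
    show "y i j = lo i j"
    proof (cases "adj N i j")
      case True
      then show ?thesis
        using tendsto_funpow_cav_map[OF eq[OF True] y] by (simp add: pow LIMSEQ_const_iff)
    next
      case False
      then show ?thesis using y off by (simp add: config_def)
    qed
  qed
qed

end

section \<open>Local continuity of vertex and edge functions\<close>

lemma Zw_image:
  assumes "inj_on \<psi> D"
  shows "Zw (\<psi> ` D) mu w = Zw D (\<lambda>F. mu (\<psi> ` F)) (\<lambda>k. w (\<psi> k))"
proof -
  have "Pow (\<psi> ` D) = (`) \<psi> ` Pow D" using image_Pow_surj[OF refl, of \<psi> D] by simp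
  then have "Zw (\<psi> ` D) mu w = (\<Sum>F\<in>Pow D. mu (\<psi> ` F) * prod w (\<psi> ` F))"
    unfolding Zw_def using inj_on_image_Pow[OF assms] by (simp add: sum.reindex)
  also have "\<dots> = Zw D (\<lambda>F. mu (\<psi> ` F)) (\<lambda>k. w (\<psi> k))"
    unfolding Zw_def
  proof (rule sum.cong)
    fix F assume "F \<in> Pow D"
    then have "inj_on \<psi> F" using inj_on_subset[OF assms] by simp
    then show "mu (\<psi> ` F) * prod w (\<psi> ` F) = mu (\<psi> ` F) * (\<Prod>k\<in>F. w (\<psi> k))"
      by (simp add: prod.reindex)
  qed simp
  finally show ?thesis .
qed

lemma cavity_ratio_image:
  assumes "inj_on \<psi> E" "e \<in> E"
  shows "cavity_ratio (\<psi> ` E) mu (\<psi> e) w = cavity_ratio E (\<lambda>F. mu (\<psi> ` F)) e (\<lambda>k. w (\<psi> k))"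
proof -
  have "\<psi> ` E - {\<psi> e} = \<psi> ` (E - {e})" using assms by (auto simp: inj_on_def)
  moreover have "inj_on \<psi> (E - {e})" by (rule inj_on_subset[OF assms(1)]) auto
  ultimately show ?thesis
    by (simp add: cavity_ratio_def Z_del_eq_Zw Z_con_eq_Zw Zw_image)
qed

section \<open>Matchings of balls\<close>

text \<open>A walk of length at most \<open>k\<close> from the root never leaves the
  radius-\<open>k\<close> ball, where adjacency is preserved. Matchings therefore do not increase
  distances from the root, which is how they are seen to respect smaller balls.\<close>

lemma walk_image:
  assumes "\<And>u v. u \<in> ball N r k \<Longrightarrow> v \<in> ball N r k \<Longrightarrow> adj N u v \<Longrightarrow> adj N' (\<phi> u) (\<phi> v)"
    and "(r, v) \<in> edge_rel N ^^ n" "n \<le> k"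
  shows "(\<phi> r, \<phi> v) \<in> edge_rel N' ^^ n"
  using assms(2,3)
proof (induction n arbitrary: v)
  case (Suc n)
  then obtain u where u: "(r, u) \<in> edge_rel N ^^ n" "adj N u v" by (auto simp: edge_rel_def)
  then have "u \<in> ball N r k" using Suc.prems unfolding ball_def by (auto intro: exI[of _ n])
  moreover have "v \<in> ball N r k" using Suc.prems unfolding ball_def by blast
  ultimately have "(\<phi> u, \<phi> v) \<in> edge_rel N'" using u assms(1) by (auto simp: edge_rel_def)
  then show ?case using Suc.IH[OF u(1)] Suc.prems by auto
qed simp

lemma root_in_ball [simp]: "r \<in> ball N r k"
  by (auto simp: ball_def intro!: exI[of _ 0])

lemma inner_ball_subset_ball: "inner_ball N r k \<subseteq> ball N r k"
  unfolding ball_def inner_ball_def by (blast intro: less_imp_le)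

lemma ball_mono: "k \<le> K \<Longrightarrow> ball N r k \<subseteq> ball N r K"
  and inner_ball_mono: "k \<le> K \<Longrightarrow> inner_ball N r k \<subseteq> inner_ball N r K"
  unfolding ball_def inner_ball_def by (blast intro: order_trans less_le_trans)+

lemma nbrs_inner_ball: "u \<in> inner_ball N r k \<Longrightarrow> nbrs N u \<subseteq> ball N r k"
proof
  fix v assume "u \<in> inner_ball N r k" "v \<in> nbrs N u"
  then obtain n where "n < k" "(r, u) \<in> edge_rel N ^^ n" "(u, v) \<in> edge_rel N"
    by (auto simp: inner_ball_def edge_rel_def)
  then show "v \<in> ball N r k" unfolding ball_def by (auto intro!: exI[of _ "Suc n"])
qed

lemma ball_match_D:
  assumes "ball_match N r N' r' k \<epsilon> \<phi>"
  shows "bij_betw \<phi> (ball N r k) (ball N' r' k)" "\<phi> r = r'"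
    "u \<in> ball N r k \<Longrightarrow> v \<in> ball N r k \<Longrightarrow> adj N u v \<longleftrightarrow> adj N' (\<phi> u) (\<phi> v)"
    "u \<in> inner_ball N r k \<Longrightarrow> F \<subseteq> nbrs N u \<Longrightarrow> 0 < lm N u F \<longleftrightarrow> 0 < lm N' (\<phi> u) (\<phi> ` F)"
    "u \<in> inner_ball N r k \<Longrightarrow> F \<subseteq> nbrs N u \<Longrightarrow> \<bar>lm N u F - lm N' (\<phi> u) (\<phi> ` F)\<bar> \<le> \<epsilon>"
  using assms by (auto simp: ball_match_def)

text \<open>Local convergence supplies maps from the approximating networks to the limit, whereas
  following a vertex of the limit takes maps the other way. That inner balls and neighbour sets are
  respected backwards comes from transporting walks and edges.\<close>

lemma ball_match_inv_into:
  assumes "ball_match N r N' r' k \<epsilon> \<phi>"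
  defines "\<psi> \<equiv> inv_into (ball N r k) \<phi>"
  shows "ball_match N' r' N r k \<epsilon> \<psi>"
proof -
  note m = ball_match_D[OF assms(1)]
  have bij: "bij_betw \<psi> (ball N' r' k) (ball N r k)"
    unfolding \<psi>_def by (rule bij_betw_inv_into[OF m(1)])
  have r: "\<psi> r' = r"
    using m(1,2) unfolding \<psi>_def by (metis bij_betw_inv_into_left root_in_ball)
  have \<phi>\<psi>: "\<phi> (\<psi> u) = u" if "u \<in> ball N' r' k" for u
    using m(1) that unfolding \<psi>_def by (rule bij_betw_inv_into_right)
  have mem: "\<psi> u \<in> ball N r k" if "u \<in> ball N' r' k" for u
    using bij that by (auto simp: bij_betw_def)
  have adj: "adj N' u v \<longleftrightarrow> adj N (\<psi> u) (\<psi> v)" if "u \<in> ball N' r' k" "v \<in> ball N' r' k" for u v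
    using m(3)[OF mem[OF that(1)] mem[OF that(2)]] \<phi>\<psi> that by simp
  have "(0 < lm N' u F \<longleftrightarrow> 0 < lm N (\<psi> u) (\<psi> ` F)) \<and> \<bar>lm N' u F - lm N (\<psi> u) (\<psi> ` F)\<bar> \<le> \<epsilon>"
    if u: "u \<in> inner_ball N' r' k" and F: "F \<subseteq> nbrs N' u" for u F
  proof -
    have ub: "u \<in> ball N' r' k" using u inner_ball_subset_ball by blast
    have Fb: "F \<subseteq> ball N' r' k" using F nbrs_inner_ball[OF u] by blast
    obtain n where n: "n < k" "(r', u) \<in> edge_rel N' ^^ n" using u by (auto simp: inner_ball_def)
    have "(\<psi> r', \<psi> u) \<in> edge_rel N ^^ n"
      by (rule walk_image[OF _ n(2), of k]) (use adj n in auto)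
    then have inner: "\<psi> u \<in> inner_ball N r k" using n r by (auto simp: inner_ball_def)
    have "\<psi> ` F \<subseteq> nbrs N (\<psi> u)"
    proof (rule image_subsetI)
      fix v assume "v \<in> F"
      then show "\<psi> v \<in> nbrs N (\<psi> u)" using F adj[OF ub subsetD[OF Fb]] by auto
    qed
    moreover have "\<phi> ` \<psi> ` F = F" using Fb \<phi>\<psi> by force
    ultimately show ?thesis
      using m(4,5)[OF inner, of "\<psi> ` F"] \<phi>\<psi>[OF ub] by (auto simp: abs_minus_commute)
  qed
  then show ?thesis unfolding ball_match_def using bij r adj by auto
qed

lemma ball_match_mono:
  assumes "ball_match N r N' r' K \<epsilon> \<phi>" "k \<le> K" "\<epsilon> \<le> \<epsilon>'"
  shows "ball_match N r N' r' k \<epsilon>' \<phi>"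
proof -
  note m = ball_match_D[OF assms(1)]
  define \<psi> where "\<psi> = inv_into (ball N r K) \<phi>"
  note m' = ball_match_D[OF ball_match_inv_into[OF assms(1)], folded \<psi>_def]
  have "\<phi> v \<in> ball N' r' k" if v: "v \<in> ball N r k" for v
  proof -
    obtain n where n: "n \<le> k" "(r, v) \<in> edge_rel N ^^ n" using v by (auto simp: ball_def)
    have "(\<phi> r, \<phi> v) \<in> edge_rel N' ^^ n"
      by (rule walk_image[OF _ n(2), of K]) (use m n assms in auto)
    then show ?thesis using n m(2) by (auto simp: ball_def)
  qed
  moreover have "\<exists>u\<in>ball N r k. v = \<phi> u" if v: "v \<in> ball N' r' k" for v
  proof -
    obtain n where n: "n \<le> k" "(r', v) \<in> edge_rel N' ^^ n" using v by (auto simp: ball_def)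
    have "(\<psi> r', \<psi> v) \<in> edge_rel N ^^ n"
      by (rule walk_image[OF _ n(2), of K]) (use m' n assms in auto)
    then have "\<psi> v \<in> ball N r k" using n m'(2) by (auto simp: ball_def)
    moreover have "\<phi> (\<psi> v) = v"
      using v ball_mono[OF assms(2)] unfolding \<psi>_def
      by (intro bij_betw_inv_into_right[OF m(1)]) auto
    ultimately show ?thesis by metis
  qed
  moreover have "inj_on \<phi> (ball N r k)"
    using m(1) ball_mono[OF assms(2)] unfolding bij_betw_def by (metis inj_on_subset)
  ultimately have "bij_betw \<phi> (ball N r k) (ball N' r' k)"
    by (auto simp: bij_betw_def)
  then show ?thesis
    unfolding ball_match_def
    using m(2-4) order_trans[OF m(5) assms(3)]
      subsetD[OF ball_mono[OF assms(2)]] subsetD[OF inner_ball_mono[OF assms(2)]]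
    by auto
qed

text \<open>The image of an inner vertex is again inner, so all its neighbours lie in the target
  ball and are hit by the matching; adjacency then pulls them back to neighbours of
  \<open>u\<close>.\<close>

lemma ball_match_nbrs:
  assumes "ball_match N r N' r' k \<epsilon> \<phi>" "u \<in> inner_ball N r k"
  shows "\<phi> ` nbrs N u = nbrs N' (\<phi> u)"
proof -
  note m = ball_match_D[OF assms(1)]
  have ub: "u \<in> ball N r k" using assms inner_ball_subset_ball by blast
  obtain n where n: "n < k" "(r, u) \<in> edge_rel N ^^ n" using assms(2) by (auto simp: inner_ball_def)
  have "(\<phi> r, \<phi> u) \<in> edge_rel N' ^^ n"
    by (rule walk_image[OF _ n(2), of k]) (use m n in auto)
  then have "\<phi> u \<in> inner_ball N' r' k" using n m(2) by (auto simp: inner_ball_def)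
  from nbrs_inner_ball[OF this] have "nbrs N' (\<phi> u) \<subseteq> \<phi> ` ball N r k"
    using m(1) by (simp add: bij_betw_def)
  then have "nbrs N' (\<phi> u) \<subseteq> \<phi> ` nbrs N u" using m(3)[OF ub] by fastforce
  moreover have "\<phi> ` nbrs N u \<subseteq> nbrs N' (\<phi> u)"
    using m(3)[OF ub] nbrs_inner_ball[OF assms(2)] by auto
  ultimately show ?thesis by blast
qed

text \<open>Local convergence to a rooted network as a filter. Carrying the matching \<open>\<psi>\<close> along lets one
  follow every vertex of the limit network, not only the root.\<close>

definition match_filter :: "network \<Rightarrow> nat \<Rightarrow> (network \<times> (nat \<Rightarrow> nat)) filter" where
  "match_filter N r = (\<Sqinter>k. principal {(N', \<psi>).
     wf_rooted (N', \<psi> r) \<and> ball_match N r N' (\<psi> r) k (1 / Suc k) \<psi>})"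

lemma eventually_match_filter:
  "eventually P (match_filter N r) \<longleftrightarrow> (\<exists>k. \<forall>N' \<psi>. wf_rooted (N', \<psi> r) \<longrightarrow>
     ball_match N r N' (\<psi> r) k (1 / Suc k) \<psi> \<longrightarrow> P (N', \<psi>))"
proof -
  have "\<exists>c. {(N', \<psi>). wf_rooted (N', \<psi> r) \<and> ball_match N r N' (\<psi> r) c (1 / Suc c) \<psi>} \<subseteq>
      {(N', \<psi>). wf_rooted (N', \<psi> r) \<and> ball_match N r N' (\<psi> r) a (1 / Suc a) \<psi>} \<inter>
      {(N', \<psi>). wf_rooted (N', \<psi> r) \<and> ball_match N r N' (\<psi> r) b (1 / Suc b) \<psi>}" for a b
  proof (intro exI[of _ "max a b"] subsetI, clarsimp)
    fix N' \<psi>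
    assume m: "ball_match N r N' (\<psi> r) (max a b) (1 / (1 + real (max a b))) \<psi>"
    show "ball_match N r N' (\<psi> r) a (1 / (1 + real a)) \<psi> \<and> ball_match N r N' (\<psi> r) b (1 / (1 + real b)) \<psi>"
      using m by (auto intro!: ball_match_mono[OF m] frac_le)
  qed
  then have "eventually P (match_filter N r) \<longleftrightarrow> (\<exists>k. eventually P (principal {(N', \<psi>).
      wf_rooted (N', \<psi> r) \<and> ball_match N r N' (\<psi> r) k (1 / Suc k) \<psi>}))"
    unfolding match_filter_def by (subst eventually_INF_base) auto
  then show ?thesis unfolding eventually_principal by blast
qed

lemma eventually_ball_match:
  assumes "0 < \<epsilon>"
  shows "\<forall>\<^sub>F (N', \<psi>) in match_filter N r. wf_rooted (N', \<psi> r) \<and> ball_match N r N' (\<psi> r) k \<epsilon> \<psi>"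
proof -
  obtain n where n: "inverse (real (Suc n)) < \<epsilon>" using reals_Archimedean[OF assms] by auto
  have "1 / real (Suc (max n k)) \<le> 1 / real (Suc n)" by (intro frac_le) auto
  then have "1 / real (Suc (max n k)) \<le> \<epsilon>" using n by (simp add: inverse_eq_divide)
  then show ?thesis
    unfolding eventually_match_filter
    by (intro exI[of _ "max n k"]) (auto intro: ball_match_mono)
qed

text \<open>By connectedness \<open>u\<close> is at the end of a walk of some length
  \<open>n\<close> from the root. It is then an inner vertex for radius \<open>n + 1\<close>, where
  its neighbours and its local measure are controlled.\<close>

lemma eventually_match_vertex:
  assumes "wf_rooted (N, r)" "u \<in> verts N" "0 < \<epsilon>"
  shows "\<forall>\<^sub>F (N', \<psi>) in match_filter N r. wf_network N' \<and> inj_on \<psi> (nbrs N u) \<and>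
    \<psi> ` nbrs N u = nbrs N' (\<psi> u) \<and>
    (\<forall>F. F \<subseteq> nbrs N u \<longrightarrow> (0 < lm N u F \<longleftrightarrow> 0 < lm N' (\<psi> u) (\<psi> ` F)) \<and>
      \<bar>lm N u F - lm N' (\<psi> u) (\<psi> ` F)\<bar> \<le> \<epsilon>)"
proof -
  have "(r, u) \<in> (edge_rel N)\<^sup>*" using assms by (auto simp: wf_rooted_def)
  then obtain n where "(r, u) \<in> edge_rel N ^^ n" by (auto simp: rtrancl_power)
  then have u: "u \<in> inner_ball N r (Suc n)" by (auto simp: inner_ball_def)
  show ?thesis
    using eventually_ball_match[OF assms(3), where N = N and r = r and k = "Suc n"]
  proof eventually_elim
    case (elim p)
    obtain N' \<psi> where p: "p = (N', \<psi>)" by (cases p)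
    with elim have wf: "wf_rooted (N', \<psi> r)" and m: "ball_match N r N' (\<psi> r) (Suc n) \<epsilon> \<psi>"
      by auto
    note d = ball_match_D[OF m]
    have "inj_on \<psi> (nbrs N u)"
      using d(1) nbrs_inner_ball[OF u] unfolding bij_betw_def by (metis inj_on_subset)
    then show ?case
      using p wf ball_match_nbrs[OF m u] d(4,5)[OF u] by (auto simp: wf_rooted_def)
  qed
qed

section \<open>Continuity followed along matchings\<close>

text \<open>Continuity is asked at every vertex of the limit, while \<open>loc_cont_r\<close> looks
  at the root only. A message is computed from messages at other vertices, so an induction on the
  number of iterations calls for this stronger form.\<close>

definition loc_cont_vertex :: "(network \<Rightarrow> nat \<Rightarrow> real) \<Rightarrow> bool" where
  "loc_cont_vertex h \<longleftrightarrow> (\<forall>N r u. wf_rooted (N, r) \<longrightarrow> u \<in> verts N \<longrightarrow>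
     ((\<lambda>p. h (fst p) (snd p u)) \<longlongrightarrow> h N u) (match_filter N r))"

definition loc_cont_edge :: "(network \<Rightarrow> nat \<Rightarrow> nat \<Rightarrow> real) \<Rightarrow> bool" where
  "loc_cont_edge h \<longleftrightarrow> (\<forall>N r u v. wf_rooted (N, r) \<longrightarrow> adj N u v \<longrightarrow>
     ((\<lambda>p. h (fst p) (snd p u) (snd p v)) \<longlongrightarrow> h N u v) (match_filter N r))"

lemma loc_cont_r_if_vertex:
  assumes "loc_cont_vertex h"
  shows "loc_cont_r (\<lambda>G. h (fst G) (snd G))"
  unfolding loc_cont_r_def
proof (intro allI impI)
  fix Gs :: "nat \<Rightarrow> rnet" and G :: rnet
  assume wfs: "\<forall>n. wf_rooted (Gs n)" and wf: "wf_rooted G" and conv: "loc_conv_r Gs G"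
  obtain N r where G: "G = (N, r)" by (cases G)
  show "(\<lambda>n. h (fst (Gs n)) (snd (Gs n))) \<longlonglongrightarrow> h (fst G) (snd G)"
  proof (rule topological_tendstoI)
    fix S assume "open S" "h (fst G) (snd G) \<in> S"
    moreover have "((\<lambda>p. h (fst p) (snd p r)) \<longlongrightarrow> h N r) (match_filter N r)"
      using assms wf G by (auto simp: loc_cont_vertex_def wf_rooted_def)
    ultimately have "\<forall>\<^sub>F p in match_filter N r. h (fst p) (snd p r) \<in> S"
      using G by (auto intro: topological_tendstoD)
    then obtain k where k: "\<And>N' \<psi>. wf_rooted (N', \<psi> r) \<Longrightarrow>
        ball_match N r N' (\<psi> r) k (1 / Suc k) \<psi> \<Longrightarrow> h N' (\<psi> r) \<in> S"
      unfolding eventually_match_filter by auto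
    have "\<forall>\<^sub>F n in sequentially. \<exists>\<phi>. ball_match (fst (Gs n)) (snd (Gs n)) N r k (1 / Suc k) \<phi>"
      using conv G by (auto simp: loc_conv_r_def)
    then show "\<forall>\<^sub>F n in sequentially. h (fst (Gs n)) (snd (Gs n)) \<in> S"
    proof eventually_elim
      case (elim n)
      then obtain \<phi> where "ball_match (fst (Gs n)) (snd (Gs n)) N r k (1 / Suc k) \<phi>" by blast
      from ball_match_inv_into[OF this] obtain \<psi>
        where m: "ball_match N r (fst (Gs n)) (snd (Gs n)) k (1 / Suc k) \<psi>" by blast
      then show ?case using k[of "fst (Gs n)" \<psi>] wfs ball_match_D(2)[OF m] by simp
    qed
  qed
qed

lemma loc_cont_d_if_edge:
  assumes "loc_cont_edge h"
  shows "loc_cont_d (\<lambda>G. h (fst G) (fst (snd G)) (snd (snd G)))"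
  unfolding loc_cont_d_def
proof (intro allI impI)
  fix Gs :: "nat \<Rightarrow> dnet" and G :: dnet
  assume wfs: "\<forall>n. wf_droot (Gs n)" and wf: "wf_droot G" and conv: "loc_conv_d Gs G"
  obtain N r s where G: "G = (N, r, s)" by (cases G) auto
  show "(\<lambda>n. h (fst (Gs n)) (fst (snd (Gs n))) (snd (snd (Gs n)))) \<longlonglongrightarrow>
      h (fst G) (fst (snd G)) (snd (snd G))"
  proof (rule topological_tendstoI)
    fix S assume "open S" "h (fst G) (fst (snd G)) (snd (snd G)) \<in> S"
    moreover have "((\<lambda>p. h (fst p) (snd p r) (snd p s)) \<longlongrightarrow> h N r s) (match_filter N r)"
      using assms wf G by (auto simp: loc_cont_edge_def wf_droot_def)
    ultimately have "\<forall>\<^sub>F p in match_filter N r. h (fst p) (snd p r) (snd p s) \<in> S"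
      using G by (auto intro: topological_tendstoD)
    then obtain k where k: "\<And>N' \<psi>. wf_rooted (N', \<psi> r) \<Longrightarrow>
        ball_match N r N' (\<psi> r) k (1 / Suc k) \<psi> \<Longrightarrow> h N' (\<psi> r) (\<psi> s) \<in> S"
      unfolding eventually_match_filter by auto
    \<comment> \<open>The extra unit of radius puts the second root inside the matched ball, also
      for \<open>k = 0\<close>; only there does inverting the matching send \<open>s\<close> back to
      the second root of the approximating network.\<close>
    let ?k = "Suc k"
    have "\<forall>\<^sub>F n in sequentially. \<exists>\<phi>. ball_match (fst (Gs n)) (fst (snd (Gs n))) N r ?k (1 / Suc k) \<phi> \<and>
        \<phi> (snd (snd (Gs n))) = s"
      using conv G by (auto simp: loc_conv_d_def)
    then show "\<forall>\<^sub>F n in sequentially. h (fst (Gs n)) (fst (snd (Gs n))) (snd (snd (Gs n))) \<in> S"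
    proof eventually_elim
      case (elim n)
      obtain N' r' s' where Gn: "Gs n = (N', r', s')" by (cases "Gs n") auto
      have "wf_droot (Gs n)" using wfs by blast
      then have wf': "wf_rooted (N', r')" "adj N' r' s'" by (simp_all add: Gn wf_droot_def)
      from elim obtain \<phi> where \<phi>: "ball_match N' r' N r ?k (1 / Suc k) \<phi>" "\<phi> s' = s"
        using Gn by auto
      define \<psi> where "\<psi> = inv_into (ball N' r' ?k) \<phi>"
      have m: "ball_match N r N' r' ?k (1 / Suc k) \<psi>"
        using ball_match_inv_into[OF \<phi>(1)] by (simp add: \<psi>_def)
      have "r' \<in> inner_ball N' r' ?k" by (auto simp: inner_ball_def intro!: exI[of _ 0])
      then have "s' \<in> ball N' r' ?k" using subsetD[OF nbrs_inner_ball] wf' by simp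
      then have "\<psi> s = s'"
        using bij_betw_inv_into_left[OF ball_match_D(1)[OF \<phi>(1)]] \<phi>(2) by (auto simp: \<psi>_def)
      moreover have "ball_match N r N' r' k (1 / Suc k) \<psi>" by (rule ball_match_mono[OF m]) auto
      ultimately show ?case using k[of N' \<psi>] wf' Gn ball_match_D(2)[OF m] by simp
    qed
  qed
qed

lemma loc_cont_edge_swap:
  assumes "loc_cont_edge h"
  shows "loc_cont_edge (\<lambda>N u v. h N v u)"
  unfolding loc_cont_edge_def
proof (intro allI impI)
  fix N r u v assume wf: "wf_rooted (N, r)" and "adj N u v"
  then have "adj N v u" using wf_networkD(3) by (auto simp: wf_rooted_def)
  then show "((\<lambda>p. h (fst p) (snd p v) (snd p u)) \<longlongrightarrow> h N v u) (match_filter N r)"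
    using assms wf by (simp add: loc_cont_edge_def)
qed

lemma loc_cont_edge_fst:
  assumes "loc_cont_vertex h"
  shows "loc_cont_edge (\<lambda>N u v. h N u)"
  unfolding loc_cont_edge_def
proof (intro allI impI)
  fix N r u v assume wf: "wf_rooted (N, r)" and "adj N u v"
  then have "u \<in> verts N" using wf_networkD(1) by (auto simp: wf_rooted_def)
  then show "((\<lambda>p. h (fst p) (snd p u)) \<longlongrightarrow> h N u) (match_filter N r)"
    using assms wf by (simp add: loc_cont_vertex_def)
qed

lemma loc_cont_vertex_sum_nbrs:
  assumes "loc_cont_edge h"
  shows "loc_cont_vertex (\<lambda>N u. \<Sum>i\<in>nbrs N u. h N u i)"
  unfolding loc_cont_vertex_def
proof (intro allI impI)
  fix N r u assume wf: "wf_rooted (N, r)" and u: "u \<in> verts N"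
  have "((\<lambda>p. \<Sum>i\<in>nbrs N u. h (fst p) (snd p u) (snd p i)) \<longlongrightarrow> (\<Sum>i\<in>nbrs N u. h N u i)) (match_filter N r)"
    using assms wf by (intro tendsto_sum) (simp add: loc_cont_edge_def)
  moreover have "\<forall>\<^sub>F p in match_filter N r. (\<Sum>i\<in>nbrs N u. h (fst p) (snd p u) (snd p i)) =
      (\<Sum>i\<in>nbrs (fst p) (snd p u). h (fst p) (snd p u) i)"
    using eventually_match_vertex[OF wf u zero_less_one]
  proof eventually_elim
    case (elim p)
    obtain N' \<psi> where p: "p = (N', \<psi>)" by (cases p)
    with elim have "inj_on \<psi> (nbrs N u)" "nbrs N' (\<psi> u) = \<psi> ` nbrs N u" by auto
    then show ?case by (simp add: p sum.reindex)
  qed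
  ultimately show "((\<lambda>p. \<Sum>i\<in>nbrs (fst p) (snd p u). h (fst p) (snd p u) i) \<longlongrightarrow>
      (\<Sum>i\<in>nbrs N u. h N u i)) (match_filter N r)"
    by (rule Lim_transform_eventually)
qed

text \<open>A matching eventually identifies the neighbourhood of \<open>u\<close> with that of its
  image, so the message can be computed over the fixed edge set of the limit with pulled-back data,
  to which continuity of the cavity ratio applies. Matchings preserve supports exactly, so the guard
  eventually has the same truth value on both sides.\<close>

lemma loc_cont_edge_msg:
  assumes "0 \<le> t"
  shows "loc_cont_edge (\<lambda>N. msg t N n)"
proof (induction n)
  case 0
  then show ?case by (simp add: loc_cont_edge_def)
next
  case (Suc n)
  show ?case
    unfolding loc_cont_edge_def
  proof (intro allI impI)
    fix N r u v assume wf: "wf_rooted (N, r)" and uv: "adj N u v"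
    have wfN: "wf_network N" using wf by (simp add: wf_rooted_def)
    have u: "u \<in> verts N" using uv wf_networkD(1)[OF wfN] by simp
    \<comment> \<open>The message of the nearby network, relabelled by the matching and guarded by
      the limit network.\<close>
    define f where "f = (\<lambda>p. if 0 < lm N u {} then
      t * cavity_ratio (nbrs N u) (\<lambda>F. lm (fst p) (snd p u) (snd p ` F)) v
        (\<lambda>k. msg t (fst p) n (snd p k) (snd p u)) else 0)"
    have lm: "((\<lambda>p. lm (fst p) (snd p u) (snd p ` F)) \<longlongrightarrow> lm N u F) (match_filter N r)"
      if "F \<subseteq> nbrs N u" for F
    proof (rule tendstoI)
      fix e :: real assume "0 < e"
      then have "0 < e / 2" by simp
      from eventually_match_vertex[OF wf u this]
      show "\<forall>\<^sub>F p in match_filter N r. dist (lm (fst p) (snd p u) (snd p ` F)) (lm N u F) < e"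
      proof eventually_elim
        case (elim p)
        then have "\<bar>lm N u F - lm (fst p) (snd p u) (snd p ` F)\<bar> \<le> e / 2"
          using that by (simp add: case_prod_beta)
        then show ?case using \<open>0 < e\<close> by (simp add: dist_real_def abs_minus_commute)
      qed
    qed
    have "(f \<longlongrightarrow> msg t N (Suc n) u v) (match_filter N r)"
    proof (cases "0 < lm N u {}")
      case True
      interpret subset_measure "nbrs N u" "lm N u"
        using subset_measure_lm[OF wfN u True] .
      have "((\<lambda>p. cavity_ratio (nbrs N u) (\<lambda>F. lm (fst p) (snd p u) (snd p ` F)) v
        (\<lambda>k. msg t (fst p) n (snd p k) (snd p u))) \<longlongrightarrow>
          cavity_ratio (nbrs N u) (lm N u) v (\<lambda>k. msg t N n k u)) (match_filter N r)"
        using Suc wf uv lm wf_networkD(3)[OF wfN] config_nonneg[OF msg_config[OF wfN assms]]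
        by (intro tendsto_cavity_ratio) (auto simp: loc_cont_edge_def)
      then show ?thesis
        using True uv by (auto simp: f_def cav_map_def cavity_op_def intro: tendsto_mult_left)
    qed (simp add: f_def)
    moreover have "\<forall>\<^sub>F p in match_filter N r. f p =
        msg t (fst p) (Suc n) (snd p u) (snd p v)"
      using eventually_match_vertex[OF wf u zero_less_one]
    proof eventually_elim
      case (elim p)
      obtain N' \<psi> where p: "p = (N', \<psi>)" by (cases p)
      with elim have wf': "wf_network N'" and inj: "inj_on \<psi> (nbrs N u)"
        and im: "\<psi> ` nbrs N u = nbrs N' (\<psi> u)"
        and pos: "0 < lm N u {} \<longleftrightarrow> 0 < lm N' (\<psi> u) {}"
        by (auto dest: spec[of _ "{}"])
      have "adj N' (\<psi> u) (\<psi> v)" using im uv by auto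
      then show ?case
        using cavity_ratio_image[OF inj, of v] uv pos
        by (simp add: p f_def im cav_map_def cavity_op_def)
    qed
    ultimately show "((\<lambda>p. msg t (fst p) (Suc n) (snd p u) (snd p v)) \<longlongrightarrow> msg t N (Suc n) u v) (match_filter N r)"
      by (rule Lim_transform_eventually)
  qed
qed

section \<open>Measurability, sums over walks and finite-level integrands\<close>

lemma borel_measurable_loc_cont_r:
  assumes "loc_cont_r f"
  shows "f \<in> borel_measurable rooted_sigma"
proof (rule borel_measurableI)
  fix S :: "real set" assume S: "open S"
  have "f -` S \<inter> Collect wf_rooted \<in> sets rooted_sigma"
    unfolding rooted_sigma_def using assms S by (subst sets_measure_of) (auto intro!: sigma_sets.Basic)
  then show "f -` S \<inter> space rooted_sigma \<in> sets rooted_sigma"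
    by (simp add: rooted_sigma_def space_measure_of_conv)
qed

lemma borel_measurable_loc_cont_d:
  assumes "loc_cont_d f"
  shows "f \<in> borel_measurable droot_sigma"
proof (rule borel_measurableI)
  fix S :: "real set" assume S: "open S"
  have "f -` S \<inter> Collect wf_droot \<in> sets droot_sigma"
    unfolding droot_sigma_def using assms S by (subst sets_measure_of) (auto intro!: sigma_sets.Basic)
  then show "f -` S \<inter> space droot_sigma \<in> sets droot_sigma"
    by (simp add: droot_sigma_def space_measure_of_conv)
qed

lemmas measurable_vertex = borel_measurable_loc_cont_r[OF loc_cont_r_if_vertex]
  and measurable_edge = borel_measurable_loc_cont_d[OF loc_cont_d_if_edge]

text \<open>The \<open>m\<close>-th iterate at the root sums \<open>h\<close> over the endpoints of the walks of length \<open>m\<close>. If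
  \<open>h \<ge> 0\<close>, it vanishes for all \<open>m\<close> only if \<open>h\<close> vanishes at every vertex.\<close>

definition nbr_sum :: "network \<Rightarrow> (nat \<Rightarrow> real) \<Rightarrow> nat \<Rightarrow> real" where
  "nbr_sum N h u = (\<Sum>i\<in>nbrs N u. h i)"

lemma loc_cont_vertex_nbr_sum_funpow:
  assumes "loc_cont_vertex h"
  shows "loc_cont_vertex (\<lambda>N. (nbr_sum N ^^ m) (h N))"
proof (induction m)
  case (Suc m)
  from loc_cont_vertex_sum_nbrs[OF loc_cont_edge_swap[OF loc_cont_edge_fst[OF this]]]
  show ?case by (simp add: nbr_sum_def[abs_def])
qed (use assms in simp)

text \<open>Finite-level form of the probability that the edge from \<open>s\<close> is present at
  \<open>r\<close> under the weights \<open>lo\<close>: the limit of \<open>a / t\<close> is the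
  odds, an incoming \<open>lo\<close> message times the cavity ratio at \<open>r\<close>.\<close>

definition edge_weight :: "real \<Rightarrow> nat \<Rightarrow> network \<Rightarrow> nat \<Rightarrow> nat \<Rightarrow> real" where
  "edge_weight t n N r s = (let a = msg t N (2 * n) s r * msg t N (Suc (2 * n)) r s in a / (t + a))"

definition gap_sum :: "real \<Rightarrow> nat \<Rightarrow> network \<Rightarrow> nat \<Rightarrow> real" where
  "gap_sum t n N u = (\<Sum>i\<in>nbrs N u. msg t N (Suc (2 * n)) i u - msg t N (2 * n) i u)"

lemma loc_cont_edge_edge_weight:
  assumes "0 < t"
  shows "loc_cont_edge (edge_weight t n)"
  unfolding loc_cont_edge_def
proof (intro allI impI)
  fix N r u v assume wf: "wf_rooted (N, r)" and uv: "adj N u v"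
  have wfN: "wf_network N" using wf by (simp add: wf_rooted_def)
  have tend: "((\<lambda>p. msg t (fst p) k (snd p i) (snd p j)) \<longlongrightarrow> msg t N k i j) (match_filter N r)"
    if "adj N i j" for k i j
    using loc_cont_edge_msg[of t k] wf that assms by (simp add: loc_cont_edge_def)
  have vu: "adj N v u" using uv wf_networkD(3)[OF wfN] by simp
  have "0 \<le> msg t N (2 * n) v u * msg t N (Suc (2 * n)) u v"
    using config_nonneg[OF msg_config[OF wfN]] assms
    by (intro mult_nonneg_nonneg) (auto simp del: msg.simps)
  then have "t + msg t N (2 * n) v u * msg t N (Suc (2 * n)) u v \<noteq> 0" using assms by linarith
  then show "((\<lambda>p. edge_weight t n (fst p) (snd p u) (snd p v)) \<longlongrightarrow> edge_weight t n N u v) (match_filter N r)"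
    unfolding edge_weight_def Let_def
    by (intro tendsto_divide tendsto_add tendsto_mult tend tendsto_const uv vu)
qed

lemma loc_cont_vertex_gap_sum:
  assumes "0 \<le> t"
  shows "loc_cont_vertex (gap_sum t n)"
proof -
  have "loc_cont_edge (\<lambda>N u i. msg t N (Suc (2 * n)) i u - msg t N (2 * n) i u)"
    using loc_cont_edge_swap[OF loc_cont_edge_msg[OF assms]]
    unfolding loc_cont_edge_def by (intro allI impI tendsto_diff) blast+
  from loc_cont_vertex_sum_nbrs[OF this] show ?thesis by (simp only: gap_sum_def[abs_def])
qed

section \<open>Mass transport\<close>

lemma nbr_sum_funpow_Suc: "(nbr_sum N ^^ Suc m) h u = (\<Sum>i\<in>nbrs N u. (nbr_sum N ^^ m) h i)"
  by (simp add: nbr_sum_def)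

lemma nbr_sum_funpow_nonneg:
  assumes "\<And>u. 0 \<le> h u"
  shows "0 \<le> (nbr_sum N ^^ m) h u"
  using assms by (induction m arbitrary: u) (simp_all add: nbr_sum_def sum_nonneg)

lemma nbr_sum_funpow_eq_0D:
  assumes "wf_network N" "\<And>u. 0 \<le> h u" "(r, v) \<in> edge_rel N ^^ m" "(nbr_sum N ^^ m) h r = 0"
  shows "h v = 0"
  using assms(3,4)
proof (induction m arbitrary: r)
  case (Suc m)
  from Suc.prems(1) obtain i where i: "(r, i) \<in> edge_rel N" "(i, v) \<in> edge_rel N ^^ m"
    by (rule relpow_Suc_E2)
  then have "finite (nbrs N r)" "i \<in> nbrs N r"
    using wf_networkD[OF assms(1)] by (auto simp: edge_rel_def)
  then have "(nbr_sum N ^^ m) h i = 0"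
    using Suc.prems(2) nbr_sum_funpow_nonneg[where h = h] assms(2)
    unfolding nbr_sum_funpow_Suc by (subst (asm) sum_nonneg_eq_0_iff) auto
  with i show ?case by (intro Suc.IH)
qed simp

context monotone_network
begin

lemma tendsto_edge_weight:
  "(\<lambda>n. edge_weight t n N r i) \<longlonglongrightarrow> lo i r * hi r i / (t + lo i r * hi r i)"
proof -
  have "0 \<le> lo i r * hi r i" using lo_nonneg order_trans[OF lo_nonneg lo_le_hi] by simp
  then have "t + lo i r * hi r i \<noteq> 0" using t_pos by linarith
  then show ?thesis
    unfolding edge_weight_def Let_def
    by (intro tendsto_divide tendsto_add tendsto_mult tendsto_const tendsto_lo tendsto_hi)
qed

definition gap :: "nat \<Rightarrow> real" where
  "gap u = (\<Sum>i\<in>nbrs N u. hi i u - lo i u)"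

lemma gap_nonneg: "0 \<le> gap u"
  unfolding gap_def by (intro sum_nonneg) (simp add: lo_le_hi)

lemma tendsto_nbr_sum_funpow_gap_sum:
  "(\<lambda>n. (nbr_sum N ^^ m) (gap_sum t n N) u) \<longlonglongrightarrow> (nbr_sum N ^^ m) gap u"
proof (induction m arbitrary: u)
  case 0
  then show ?case
    unfolding gap_sum_def gap_def funpow_0 by (intro tendsto_sum tendsto_diff tendsto_lo tendsto_hi)
next
  case (Suc m)
  then show ?case unfolding nbr_sum_funpow_Suc by (intro tendsto_sum)
qed

lemma lo_eq_hi_if_nbr_sum_funpow_gap_eq_0:
  assumes "wf_rooted (N, r)" "\<And>m. (nbr_sum N ^^ m) gap r = 0" "adj N i j"
  shows "lo i j = hi i j"
proof -
  have j: "j \<in> verts N" using assms(3) wf_networkD[OF wf] by blast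
  then have "(r, j) \<in> (edge_rel N)\<^sup>*" using assms(1) by (simp add: wf_rooted_def)
  then obtain m where "(r, j) \<in> edge_rel N ^^ m" by (auto simp: rtrancl_power)
  then have "gap j = 0" using nbr_sum_funpow_eq_0D[OF wf gap_nonneg _ assms(2)] by blast
  moreover have "finite (nbrs N j)" "i \<in> nbrs N j" using j assms(3) wf_networkD[OF wf] by auto
  ultimately have "hi i j - lo i j = 0"
    unfolding gap_def by (subst (asm) sum_nonneg_eq_0_iff) (auto simp: lo_le_hi)
  then show ?thesis by simp
qed

end

section \<open>Mass transport: equality at the root, then at all vertices\<close>

theorem mainTheorem5:
  fixes L :: "rnet measure"
  assumes "prob_space L"
    and "sets L = sets rooted_sigma"
    and "unimodular L"
    and "AE G in L. cavity_monotone_network (fst G)"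
    and "(\<integral>\<^sup>+ G. of_nat (rank_of (nbrs (fst G) (snd G)) (lm (fst G) (snd G))) \<partial>L) < \<infinity>"
  shows "\<forall>t::real. 0 < t \<longrightarrow> (AE G in L.
     \<exists>x\<in>config (fst G). cav_map (fst G) t x = x \<and>
       (\<forall>y\<in>config (fst G). cav_map (fst G) t y = y \<longrightarrow> y = x) \<and>
       (\<forall>x0\<in>config (fst G). \<forall>i j. adj (fst G) i j \<longrightarrow>
          (\<lambda>n. ((cav_map (fst G) t) ^^ n) x0 i j) \<longlonglongrightarrow> x i j))"
proof (intro allI impI)
  fix t :: real assume t: "0 < t"
  have "space L = Collect wf_rooted"
    using sets_eq_imp_space_eq[OF assms(2)] by (simp add: rooted_sigma_def space_measure_of_conv)
  then have AE_wf: "AE G in L. wf_rooted G" by (intro AE_I2) simp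
  have good: "AE G in L. wf_rooted G \<and> monotone_network (fst G) t"
    using AE_wf assms(4)
    by eventually_elim (use t in \<open>auto simp: monotone_network_def wf_rooted_def\<close>)
  have meas_cong: "borel_measurable L = borel_measurable rooted_sigma"
    using assms(2) by (rule measurable_cong_sets) simp
  have transport: "(\<integral>\<^sup>+ G. (\<Sum>i\<in>nbrs (fst G) (snd G). f (fst G, snd G, i)) \<partial>L) =
      (\<integral>\<^sup>+ G. (\<Sum>i\<in>nbrs (fst G) (snd G). f (fst G, i, snd G)) \<partial>L)"
    if "f \<in> borel_measurable droot_sigma" for f :: "dnet \<Rightarrow> ennreal"
    using assms(3) that by (simp add: unimodular_def)

  \<comment> \<open>\<open>P\<close>, \<open>Q\<close> and \<open>f\<close> are defined on all
    networks through \<open>lim\<close>, with an arbitrary value where the limit fails to exist.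
    They are thus measurable outright, and are identified with expressions in \<open>lo\<close> and
    \<open>hi\<close> on the almost sure event \<open>good\<close>.\<close>
  define P where "P G = ennreal (lim (\<lambda>n. \<Sum>i\<in>nbrs (fst G) (snd G). edge_weight t n (fst G) (snd G) i))"
    for G :: rnet
  define Q where "Q G = ennreal (lim (\<lambda>n. \<Sum>i\<in>nbrs (fst G) (snd G). edge_weight t n (fst G) i (snd G)))"
    for G :: rnet
  define f where "f G = ennreal (lim (\<lambda>n. edge_weight t n (fst G) (fst (snd G)) (snd (snd G))))"
    for G :: dnet
  have P_meas [measurable]: "P \<in> borel_measurable L"
    unfolding P_def meas_cong
    by (intro measurable_compose[OF _ measurable_ennreal] borel_measurable_lim_metric
        measurable_vertex loc_cont_vertex_sum_nbrs loc_cont_edge_edge_weight t)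
  have Q_meas [measurable]: "Q \<in> borel_measurable L"
    unfolding Q_def meas_cong
    by (intro measurable_compose[OF _ measurable_ennreal] borel_measurable_lim_metric
        measurable_vertex loc_cont_vertex_sum_nbrs loc_cont_edge_swap[OF loc_cont_edge_edge_weight] t)
  have f_meas: "f \<in> borel_measurable droot_sigma"
    unfolding f_def
    by (intro measurable_compose[OF _ measurable_ennreal] borel_measurable_lim_metric
        measurable_edge loc_cont_edge_edge_weight t)

  have local: "P G = ennreal (exp_size (nbrs N r) (lm N r) (\<lambda>k. monotone_network.lo N t k r)) \<and>
      Q G = ennreal (exp_size (nbrs N r) (lm N r) (\<lambda>k. monotone_network.hi N t k r)) \<and>
      (\<Sum>i\<in>nbrs N r. f (N, r, i)) = P G \<and> (\<Sum>i\<in>nbrs N r. f (N, i, r)) = Q G"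
    if G: "G = (N, r)" "wf_rooted G" "monotone_network N t" for G N r
  proof -
    interpret monotone_network N t by fact
    have r: "r \<in> verts N" using G by (simp add: wf_rooted_def)
    let ?w = "\<lambda>r i. lo i r * hi r i / (t + lo i r * hi r i)"
    have w_nonneg: "0 \<le> ?w r i" for r i
      using t_pos lo_nonneg order_trans[OF lo_nonneg lo_le_hi]
      by (intro divide_nonneg_nonneg add_nonneg_nonneg mult_nonneg_nonneg) auto
    have f: "f (N, r, i) = ennreal (?w r i)" for r i
      using limI[OF tendsto_edge_weight] by (simp add: f_def)
    have P: "P G = ennreal (\<Sum>i\<in>nbrs N r. ?w r i)"
      unfolding P_def G(1) fst_conv snd_conv by (subst limI[OF tendsto_sum[OF tendsto_edge_weight]]) simp
    have Q: "Q G = ennreal (\<Sum>i\<in>nbrs N r. ?w i r)"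
      unfolding Q_def G(1) fst_conv snd_conv by (subst limI[OF tendsto_sum[OF tendsto_edge_weight]]) simp
    show ?thesis
      using sum_lo_hi_eq_exp_size[OF r] by (simp add: f P Q sum_ennreal[OF w_nonneg])
  qed

  have sums: "AE G in L. (\<Sum>i\<in>nbrs (fst G) (snd G). f (fst G, snd G, i)) = P G \<and>
      (\<Sum>i\<in>nbrs (fst G) (snd G). f (fst G, i, snd G)) = Q G"
    using good
  proof eventually_elim
    case (elim G)
    then show ?case using local[of G "fst G" "snd G"] by simp
  qed
  have "(\<integral>\<^sup>+ G. P G \<partial>L) = (\<integral>\<^sup>+ G. (\<Sum>i\<in>nbrs (fst G) (snd G). f (fst G, snd G, i)) \<partial>L)"
    using sums by (intro nn_integral_cong_AE) (auto elim!: eventually_mono)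
  also have "\<dots> = (\<integral>\<^sup>+ G. (\<Sum>i\<in>nbrs (fst G) (snd G). f (fst G, i, snd G)) \<partial>L)"
    by (rule transport[OF f_meas])
  also have "\<dots> = (\<integral>\<^sup>+ G. Q G \<partial>L)"
    using sums by (intro nn_integral_cong_AE) (auto elim!: eventually_mono)
  finally have PQ: "(\<integral>\<^sup>+ G. P G \<partial>L) = (\<integral>\<^sup>+ G. Q G \<partial>L)" .
  have le: "AE G in L. P G \<le> Q G"
    using good
  proof eventually_elim
    case (elim G)
    obtain N r where G: "G = (N, r)" by (cases G)
    show ?case
      using local[OF G] elim monotone_network.exp_size_lo_le_hi[of N t r] G
      by (auto simp: wf_rooted_def intro!: ennreal_leI)
  qed
  have "(\<integral>\<^sup>+ G. Q G \<partial>L) \<le> (\<integral>\<^sup>+ G. of_nat (rank_of (nbrs (fst G) (snd G)) (lm (fst G) (snd G))) \<partial>L)"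
  proof (rule nn_integral_mono_AE)
    show "AE G in L. Q G \<le> of_nat (rank_of (nbrs (fst G) (snd G)) (lm (fst G) (snd G)))"
      using good
    proof eventually_elim
      case (elim G)
      obtain N r where G: "G = (N, r)" by (cases G)
      show ?case
        using local[OF G] elim monotone_network.exp_size_hi_le_rank[of N t r] G
        by (auto simp: wf_rooted_def ennreal_of_nat_eq_real_of_nat intro!: ennreal_leI)
    qed
  qed
  then have Q_fin: "(\<integral>\<^sup>+ G. Q G \<partial>L) < \<infinity>" using assms(5) by (rule order_le_less_trans)
  \<comment> \<open>Two equal integrals may be subtracted because they are finite, and this is where
    the integrability of the rank enters.\<close>
  have "(\<integral>\<^sup>+ G. Q G - P G \<partial>L) = 0"
    using PQ Q_fin le by (subst nn_integral_diff) auto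
  then have "AE G in L. Q G - P G = 0" by (subst (asm) nn_integral_0_iff_AE) auto
  \<comment> \<open>Subtraction in \<open>ennreal\<close> is truncated, so a zero difference gives
    only \<open>Q G \<le> P G\<close>; the pointwise bound \<open>le\<close> supplies the
    converse.\<close>
  with le have eq: "AE G in L. P G = Q G"
  proof eventually_elim
    case (elim G)
    then show ?case by (metis add_0_right diff_add_cancel_ennreal add.commute)
  qed

  define W where "W m G = ennreal (lim (\<lambda>n. (nbr_sum (fst G) ^^ m) (gap_sum t n (fst G)) (snd G)))"
    for m and G :: rnet
  have W_meas [measurable]: "W m \<in> borel_measurable L" for m
    unfolding W_def meas_cong using t
    by (intro measurable_compose[OF _ measurable_ennreal] borel_measurable_lim_metric
        measurable_vertex loc_cont_vertex_nbr_sum_funpow loc_cont_vertex_gap_sum) simp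
  have W_eq: "W m (N, u) = ennreal ((nbr_sum N ^^ m) (monotone_network.gap N t) u)"
    if "monotone_network N t" for m N u
    using limI[OF monotone_network.tendsto_nbr_sum_funpow_gap_sum[OF that]] by (simp add: W_def)
  have W_0: "AE G in L. W m G = 0" for m
  proof (induction m)
    case 0
    from good eq show ?case
    proof eventually_elim
      case (elim G)
      obtain N r where G: "G = (N, r)" by (cases G)
      with elim interpret monotone_network N t by simp
      have r: "r \<in> verts N" using elim G by (simp add: wf_rooted_def)
      \<comment> \<open>\<open>ennreal\<close> sends all negative reals to 0, so an equality of its
        values descends to the reals only for nonnegative arguments.\<close>
      have nonneg: "0 \<le> exp_size (nbrs N r) (lm N r) (\<lambda>k. x k r)" if "\<And>i j. 0 \<le> x i j" for x
        using that r subset_measure.cavity_ratio_nonneg[OF local_measure(1)[OF r]]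
        by (subst subset_measure.exp_size_eq_sum_cavity[OF local_measure(1)[OF r]])
          (auto intro!: sum_nonneg divide_nonneg_nonneg add_nonneg_nonneg mult_nonneg_nonneg)
      have "exp_size (nbrs N r) (lm N r) (\<lambda>k. lo k r) = exp_size (nbrs N r) (lm N r) (\<lambda>k. hi k r)"
        using local[OF G] elim G nonneg[of lo] nonneg[of hi] lo_nonneg order_trans[OF lo_nonneg lo_le_hi]
        by auto
      from lo_eq_hi_if_exp_size_eq[OF this] have "gap r = 0" by (simp add: gap_def)
      then show ?case using W_eq[of N 0 r] G monotone_network_axioms by simp
    qed
  next
    case (Suc m)
    \<comment> \<open>A mass depending only on its first vertex. Sent from the root it totals the
      degree times \<open>W m\<close> at the root, almost surely 0; received at the root it totals
      the sum of \<open>W m\<close> over the neighbours, which is \<open>W (Suc m)\<close>.\<close>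
    define g where "g G = W m (fst G, fst (snd G))" for G :: dnet
    have "g \<in> borel_measurable droot_sigma"
      unfolding g_def W_def fst_conv snd_conv using t
      by (intro measurable_compose[OF _ measurable_ennreal] borel_measurable_lim_metric
          measurable_edge loc_cont_edge_fst loc_cont_vertex_nbr_sum_funpow loc_cont_vertex_gap_sum) simp
    from transport[OF this]
    have "(\<integral>\<^sup>+ G. (\<Sum>i\<in>nbrs (fst G) (snd G). W m (fst G, i)) \<partial>L) =
        (\<integral>\<^sup>+ G. (\<Sum>i\<in>nbrs (fst G) (snd G). W m (fst G, snd G)) \<partial>L)"
      by (simp add: g_def)
    also have "\<dots> = (\<integral>\<^sup>+ G. 0 \<partial>L)"
      using Suc by (intro nn_integral_cong_AE) (auto elim!: eventually_mono)
    finally have "(\<integral>\<^sup>+ G. (\<Sum>i\<in>nbrs (fst G) (snd G). W m (fst G, i)) \<partial>L) = 0" by simp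
    moreover have "(\<integral>\<^sup>+ G. W (Suc m) G \<partial>L) =
        (\<integral>\<^sup>+ G. (\<Sum>i\<in>nbrs (fst G) (snd G). W m (fst G, i)) \<partial>L)"
    proof (rule nn_integral_cong_AE)
      from good show "AE G in L. W (Suc m) G = (\<Sum>i\<in>nbrs (fst G) (snd G). W m (fst G, i))"
      proof eventually_elim
        case (elim G)
        obtain N r where G: "G = (N, r)" by (cases G)
        with elim interpret monotone_network N t by simp
        show ?case
          using nbr_sum_funpow_nonneg[where h = gap] gap_nonneg
          by (simp add: G W_eq monotone_network_axioms sum_ennreal nbr_sum_funpow_Suc
              del: funpow.simps)
      qed
    qed
    ultimately have "(\<integral>\<^sup>+ G. W (Suc m) G \<partial>L) = 0" by simp
    then show ?case by (subst (asm) nn_integral_0_iff_AE) auto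
  qed
  have "AE G in L. \<forall>m. W m G = 0" using W_0 by (simp add: AE_all_countable)
  with good show "AE G in L.
     \<exists>x\<in>config (fst G). cav_map (fst G) t x = x \<and>
       (\<forall>y\<in>config (fst G). cav_map (fst G) t y = y \<longrightarrow> y = x) \<and>
       (\<forall>x0\<in>config (fst G). \<forall>i j. adj (fst G) i j \<longrightarrow>
          (\<lambda>n. ((cav_map (fst G) t) ^^ n) x0 i j) \<longlonglongrightarrow> x i j)"
  proof eventually_elim
    case (elim G)
    obtain N r where G: "G = (N, r)" by (cases G)
    with elim interpret monotone_network N t by simp
    have "(nbr_sum N ^^ m) gap r = 0" for m
      using elim G W_eq[of N m r] nbr_sum_funpow_nonneg[where h = gap] gap_nonneg monotone_network_axioms
      by simp
    then show ?case
      using globally_attractive_solution lo_eq_hi_if_nbr_sum_funpow_gap_eq_0 elim G by auto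
  qed
qed

end
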